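(* Assume $\rho$ is non-unimodular. Then $\mathrm{P}_\rho$ has a global coordinate system $(u,v,x)\in\mathbb{R}^+\times\mathbb{R}\times\mathbb{R}$ in which the metric has the form $$g=2\,du\,dv+\frac{b(\rho)x^2}{u^2}\,du^2+dx^2 .$$ The invariant $b(\rho)$ is defined by $\rho(t)=e^{tA}$, where $$A=\begin{pmatrix}1&0&0\\0&0&1\\0&b&1\end{pmatrix}$$ acts on the Lie algebra $\mathfrak{heis}$ endowed with the basis $\{Z,X,Y\}$, $[X,Y]=Z$. Moreover, for non-unimodular $\rho,\rho'$, the groups $G_\rho$ and $G_{\rho'}$ are isomorphic if and only if $b(\rho)=b(\rho')$.
   Context: Let $\mathrm{Heis}$ be the simply connected $3$-dimensional Heisenberg group, $\mathfrak{heis}=\mathrm{span}(Z,X,Y)$ its Lie algebra with $[X,Y]=Z$ and center $\mathbb{R}Z$, $\rho:\mathbb{R}\to\mathrm{Aut}(\mathrm{Heis})$ a one-parameter group of automorphisms (viewed also as acting on $\mathfrak{heis}$), and $G_\rho=\mathbb{R}\ltimes_\rho\mathrm{Heis}$; $\rho$ is non-unimodular if $G_\rho$ is not unimodular (equivalently $\rho$ does not fix $Z$). Let $W\in\mathfrak{heis}$ be non-central and such that its image in $\mathfrak{heis}/\mathbb{R}Z$ is not a common eigenvector of the $\rho(t)$ (it is part of the setting that such $W$ exists), and let $I$ be the one-parameter subgroup generated by $W$. Then $\mathrm{P}_\rho=G_\rho/I$ carries a $G_\rho$-invariant Lorentz metric, and it is endowed with such a metric (unique up to scaling and automorphisms of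 $G_\rho$ fixing $W$). Definition of $b(\rho)$: write $\rho(t)=e^{tA}$ with $A$ a derivation of $\mathfrak{heis}$, $A(Z)\neq0$. Replacing $A$ by $\alpha A+\mathrm{ad}_w$ ($\alpha\in\mathbb{R}\setminus\{0\}$, $w\in\mathfrak{heis}$), which gives an isomorphic semi-direct product, and conjugating by an automorphism of $\mathfrak{heis}$, one can bring $A$ to the matrix form displayed in the claim (that is, $AZ=Z$, $AX=bY$, $AY=X+Y$); then $b(\rho)=b$. *)

theory Defs
  imports "HOL-Analysis.Analysis" "HOL-Algebra.Left_Coset"
begin

section \<open>Smooth maps\<close>

text \<open>\<open>C\<^sup>n\<close> and \<open>C\<^sup>\<infinity>\<close> maps on an open subset of a finite-dimensional space: all iterated
  directional derivatives exist and are continuous.\<close>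

primrec Ck_on :: "nat \<Rightarrow> 'a::real_normed_vector set \<Rightarrow> ('a \<Rightarrow> 'b::real_normed_vector) \<Rightarrow> bool" where
  "Ck_on 0 S f \<longleftrightarrow> continuous_on S f"
| "Ck_on (Suc n) S f \<longleftrightarrow> (\<forall>x\<in>S. f differentiable (at x)) \<and>
     (\<forall>v. Ck_on n S (\<lambda>x. frechet_derivative f (at x) v))"

definition smooth_on :: "'a::real_normed_vector set \<Rightarrow> ('a \<Rightarrow> 'b::real_normed_vector) \<Rightarrow> bool" where
  "smooth_on S f \<longleftrightarrow> (\<forall>n. Ck_on n S f)"


section \<open>The Heisenberg algebra and group\<close>

text \<open>The components 1, 2, 3 are the coordinates in the basis \<open>Z, X, Y\<close>.\<close>

type_synonym heis = "real^3"

definition heis_Z :: heis where "heis_Z = axis 1 1"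

definition bracket :: "heis \<Rightarrow> heis \<Rightarrow> heis" where
  "bracket v w = (v$2 * w$3 - v$3 * w$2) *\<^sub>R heis_Z"

definition derivation :: "(heis \<Rightarrow> heis) \<Rightarrow> bool" where
  "derivation A \<longleftrightarrow> linear A \<and>
     (\<forall>v w. A (bracket v w) = bracket (A v) w + bracket v (A w))"

definition lie_automorphism :: "(heis \<Rightarrow> heis) \<Rightarrow> bool" where
  "lie_automorphism \<phi> \<longleftrightarrow> linear \<phi> \<and> bij \<phi> \<and>
     (\<forall>v w. \<phi> (bracket v w) = bracket (\<phi> v) (\<phi> w))"

text \<open>The simply connected group in exponential coordinates: the product is the
  Baker-Campbell-Hausdorff formula and the exponential map is the identity. Hence an
  automorphism of the Lie group and its differential, an automorphism of the Lie algebra,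
  are the same map \<open>heis \<Rightarrow> heis\<close>.\<close>

definition Heis :: "heis monoid" where
  "Heis = \<lparr>carrier = UNIV, mult = (\<lambda>p q. p + q + (1/2) *\<^sub>R bracket p q), one = 0\<rparr>"

definition one_parameter_group :: "(real \<Rightarrow> heis \<Rightarrow> heis) \<Rightarrow> bool" where
  "one_parameter_group \<rho> \<longleftrightarrow>
     (\<forall>t. \<rho> t \<in> iso Heis Heis) \<and> (\<forall>s t. \<rho> (s + t) = \<rho> s \<circ> \<rho> t) \<and>
     continuous_on UNIV (\<lambda>(t, p). \<rho> t p)"


section \<open>The groups \<open>G\<^sub>\<rho>\<close>\<close>

definition G_rho :: "(real \<Rightarrow> heis \<Rightarrow> heis) \<Rightarrow> (real \<times> heis) monoid" where
  "G_rho \<rho> = \<lparr>carrier = UNIV,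
           mult = (\<lambda>(s, p) (t, q). (s + t, p \<otimes>\<^bsub>Heis\<^esub> \<rho> s q)),
           one = (0, \<one>\<^bsub>Heis\<^esub>)\<rparr>"

text \<open>For topological groups whose carrier is the whole type: there is a bi-invariant
  Haar measure.\<close>

definition unimodular :: "'a::topological_space monoid \<Rightarrow> bool" where
  "unimodular H \<longleftrightarrow> (\<exists>M :: 'a measure.
     sets M = sets borel \<and> emeasure M UNIV \<noteq> 0 \<and> (\<forall>K. compact K \<longrightarrow> emeasure M K < \<infinity>) \<and>
     (\<forall>g. distr M borel (\<lambda>x. g \<otimes>\<^bsub>H\<^esub> x) = M \<and> distr M borel (\<lambda>x. x \<otimes>\<^bsub>H\<^esub> g) = M))"

definition lie_isomorphic ::
    "'a::real_normed_vector monoid \<Rightarrow> 'b::real_normed_vector monoid \<Rightarrow> bool" where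
  "lie_isomorphic H K \<longleftrightarrow>
     (\<exists>F. F \<in> iso H K \<and> smooth_on UNIV F \<and> smooth_on UNIV (inv_into UNIV F))"


section \<open>The invariant \<open>b(\<rho>)\<close>\<close>

text \<open>\<open>\<rho>(t) = exp(tA)\<close>\<close>

definition generates :: "(heis \<Rightarrow> heis) \<Rightarrow> (real \<Rightarrow> heis \<Rightarrow> heis) \<Rightarrow> bool" where
  "generates A \<rho> \<longleftrightarrow> (\<forall>t v. (\<lambda>n. (t ^ n / fact n) *\<^sub>R (A ^^ n) v) sums \<rho> t v)"

definition normal_form :: "real \<Rightarrow> real^3^3" where
  "normal_form b = vector [vector [1, 0, 0],
                           vector [0, 0, 1],
                           vector [0, b, 1]]"

definition has_normal_form :: "(real \<Rightarrow> heis \<Rightarrow> heis) \<Rightarrow> real \<Rightarrow> bool" where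
  "has_normal_form \<rho> b \<longleftrightarrow>
     (\<exists>A \<alpha> w \<phi>. derivation A \<and> generates A \<rho> \<and> \<alpha> \<noteq> 0 \<and> lie_automorphism \<phi> \<and>
        (\<forall>v. \<phi> (\<alpha> *\<^sub>R A v + bracket w v) = normal_form b *v \<phi> v))"

definition b_invariant :: "(real \<Rightarrow> heis \<Rightarrow> heis) \<Rightarrow> real" where
  "b_invariant \<rho> = (THE b. has_normal_form \<rho> b)"


section \<open>The homogeneous space \<open>P\<^sub>\<rho> = G\<^sub>\<rho>/I\<close>\<close>

definition admissible :: "(real \<Rightarrow> heis \<Rightarrow> heis) \<Rightarrow> heis \<Rightarrow> bool" where
  "admissible \<rho> W \<longleftrightarrow> (\<exists>v. bracket W v \<noteq> 0) \<and>
     \<not> (\<forall>t. \<exists>c. \<rho> t W - c *\<^sub>R W \<in> span {heis_Z})"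

definition one_param_subgroup :: "heis \<Rightarrow> (real \<times> heis) set" where
  "one_param_subgroup W = range (\<lambda>s. (0, s *\<^sub>R W))"

type_synonym point = "(real \<times> heis) set"
type_synonym chart = "point set \<times> (point \<Rightarrow> real^3)"

definition P_rho :: "(real \<Rightarrow> heis \<Rightarrow> heis) \<Rightarrow> heis \<Rightarrow> point set" where
  "P_rho \<rho> W = lcosets\<^bsub>G_rho \<rho>\<^esub> (one_param_subgroup W)"

definition proj :: "(real \<Rightarrow> heis \<Rightarrow> heis) \<Rightarrow> heis \<Rightarrow> real \<times> heis \<Rightarrow> point" where
  "proj \<rho> W g = g <#\<^bsub>G_rho \<rho>\<^esub> one_param_subgroup W"

text \<open>The maximal atlas of the quotient manifold, whose smooth structure is the one making the
  projection a smooth submersion: as the dimension of the quotient is 3, an injective map from an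
  open set to \<open>\<real>\<^sup>3\<close> is a chart iff its composition with the projection is a smooth submersion.
  The values of a chart outside its domain are irrelevant.\<close>

definition charts :: "(real \<Rightarrow> heis \<Rightarrow> heis) \<Rightarrow> heis \<Rightarrow> chart set" where
  "charts \<rho> W = {(U, \<phi>). U \<subseteq> P_rho \<rho> W \<and> inj_on \<phi> U \<and>
     open (proj \<rho> W -` U) \<and> smooth_on (proj \<rho> W -` U) (\<phi> \<circ> proj \<rho> W) \<and>
     (\<forall>g \<in> proj \<rho> W -` U. surj (frechet_derivative (\<phi> \<circ> proj \<rho> W) (at g)))}"

text \<open>Signature \<open>(-,+,+)\<close>.\<close>

definition lorentz_form :: "real^3^3 \<Rightarrow> bool" where
  "lorentz_form S \<longleftrightarrow> transpose S = S \<and>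
     (\<exists>Q :: real^3^3. invertible Q \<and> transpose Q ** S ** Q =
        vector [vector [-1, 0, 0],
                vector [0, 1, 0],
                vector [0, 0, 1]])"

text \<open>A metric is given by its component matrices in all the charts, which are related by the
  usual transformation law for covariant 2-tensors.\<close>

definition lorentz_metric :: "chart set \<Rightarrow> (chart \<Rightarrow> real^3 \<Rightarrow> real^3^3) \<Rightarrow> bool" where
  "lorentz_metric C m \<longleftrightarrow>
     (\<forall>(U, \<phi>) \<in> C. smooth_on (\<phi> ` U) (m (U, \<phi>)) \<and> (\<forall>y \<in> \<phi> ` U. lorentz_form (m (U, \<phi>) y))) \<and>
     (\<forall>(U, \<phi>) \<in> C. \<forall>(V, \<psi>) \<in> C. \<forall>p \<in> U \<inter> V.
        let J = matrix (frechet_derivative (\<psi> \<circ> inv_into U \<phi>) (at (\<phi> p)))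
        in m (U, \<phi>) (\<phi> p) = transpose J ** m (V, \<psi>) (\<psi> p) ** J)"

text \<open>Left translation by \<open>a\<close> pulls the chart \<open>(U, \<phi>)\<close> back to the chart
  \<open>(a\<^sup>-\<^sup>1U, \<phi> \<circ> a)\<close>; it is an isometry iff the metric has the same components in the two
  charts.\<close>

definition translate_chart :: "(real \<Rightarrow> heis \<Rightarrow> heis) \<Rightarrow> heis \<Rightarrow> real \<times> heis \<Rightarrow> chart \<Rightarrow> chart" where
  "translate_chart \<rho> W a = (\<lambda>(U, \<phi>).
     ({p \<in> P_rho \<rho> W. a <#\<^bsub>G_rho \<rho>\<^esub> p \<in> U}, \<lambda>p. \<phi> (a <#\<^bsub>G_rho \<rho>\<^esub> p)))"

definition invariant_lorentz_metric ::
    "(real \<Rightarrow> heis \<Rightarrow> heis) \<Rightarrow> heis \<Rightarrow> (chart \<Rightarrow> real^3 \<Rightarrow> real^3^3) \<Rightarrow> bool" where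
  "invariant_lorentz_metric \<rho> W m \<longleftrightarrow> lorentz_metric (charts \<rho> W) m \<and>
     (\<forall>a. \<forall>(U, \<phi>) \<in> charts \<rho> W. \<forall>y \<in> \<phi> ` U.
        m (translate_chart \<rho> W a (U, \<phi>)) y = m (U, \<phi>) y)"

text \<open>The quadratic form \<open>2 du dv + (b x\<^sup>2/u\<^sup>2) du\<^sup>2 + dx\<^sup>2\<close> at \<open>(u,v,x) = y\<close>, evaluated on the
  tangent vector \<open>\<xi> = (du,dv,dx)\<close>.\<close>

definition plane_wave :: "real \<Rightarrow> real^3 \<Rightarrow> real^3 \<Rightarrow> real" where
  "plane_wave b y \<xi> =
     2 * \<xi>$1 * \<xi>$2 + b * (y$3)\<^sup>2 / (y$1)\<^sup>2 * (\<xi>$1)\<^sup>2 + (\<xi>$3)\<^sup>2"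

end

theory Submission
  imports Defs
begin

text \<open>
  Everything reduces to one model for each \<open>b\<close>: the semidirect product defined by the flow of the
  normal form \<open>N\<close>, with \<open>N Z = Z\<close>, \<open>N X = b *\<^sub>R Y\<close> and \<open>N Y = X + Y\<close>, and its subgroup generated by \<open>Y\<close>.

  Reduction. A continuous one-parameter group \<open>\<rho>\<close> consists of linear maps and has a generator \<open>A\<close>, a
  derivation (\<open>one_parameter_group_lie_flow\<close>). It multiplies the centre by a number, the rate. If the
  rate is 0, Lebesgue measure on \<open>G\<^sub>\<rho>\<close> is bi-invariant (\<open>unimodular_if_rate_0\<close>); so the rate is not 0,
  and \<open>A\<close> divided by it has trace 1 modulo the centre. An admissible \<open>W\<close> is a cyclic vector of this
  2 by 2 matrix, hence brings it to companion form with \<open>b\<close> equal to minus the determinant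
  (\<open>normal_form_basis\<close>). This gives existence and uniqueness of the normal form. The correction
  \<open>ad w\<close> amounts to another choice of the one-parameter subgroup complementing \<open>Heis\<close>; integrating it yields
  an explicit isomorphism from the model onto \<open>G\<^sub>\<rho>\<close> that carries \<open>Y\<close> to \<open>W\<close> (\<open>model_isomorphism\<close>).

  Geometry. In the model, with \<open>\<eta> = \<tau> (- t) p\<close>, the functions \<open>u = exp (- t)\<close>,
  \<open>v = exp t * (\<eta>$1 - \<eta>$2 * \<eta>$3 / 2)\<close> and \<open>x = \<eta>$2\<close> of \<open>(t, p)\<close> separate precisely the cosets of the
  subgroup generated by \<open>Y\<close>, so they are global coordinates on the quotient, in which left translations
  are explicit. The isotropy group of \<open>(1, 0, 0)\<close> acts by null rotations, whose only invariant Lorentz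
  forms are \<open>a * (2 du dv + dx\<^sup>2) + c * du\<^sup>2\<close> with \<open>a > 0\<close> (\<open>null_rotation_invariant_form\<close>). Translating
  them to the other points gives \<open>a\<close> times the plane wave plus \<open>c * du\<^sup>2 / u\<^sup>2\<close>, and a change of \<open>v\<close> and
  \<open>x\<close> removes both constants (\<open>plane_wave_chart\<close>).

  Classification. An isomorphism of models preserves \<open>Heis\<close>, because elements outside it do not act
  unipotently. It preserves the parameter \<open>t\<close>, because \<open>(t, 0)\<close> scales the centre by \<open>exp t\<close>. So it
  intertwines the two flows modulo the centre, and the determinants of their generators agree
  (\<open>model_iso_imp_eq\<close>).
\<close>

section \<open>Calculus of smooth maps\<close>

lemma Ck_on_cong:
  assumes "open S" "\<And>x. x \<in> S \<Longrightarrow> f x = g x" "Ck_on n S f"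
  shows "Ck_on n S g"
  using assms(2,3)
proof (induction n arbitrary: f g)
  case 0
  then show ?case by (simp cong: continuous_on_cong)
next
  case (Suc n)
  have d: "f differentiable at x" if "x \<in> S" for x using Suc.prems that by auto
  have g: "g differentiable at x" if "x \<in> S" for x
  proof -
    obtain D where "(f has_derivative D) (at x)" using d[OF \<open>x \<in> S\<close>] by (auto simp: differentiable_def)
    from has_derivative_transform_within_open[OF this assms(1) \<open>x \<in> S\<close>] Suc.prems(1)
    show ?thesis by (auto simp: differentiable_def)
  qed
  have "Ck_on n S (\<lambda>x. frechet_derivative g (at x) v)" for v
  proof (rule Suc.IH[of "\<lambda>x. frechet_derivative f (at x) v"])
    show "frechet_derivative f (at x) v = frechet_derivative g (at x) v" if "x \<in> S" for x
      using frechet_derivative_transform_within_open[OF d[OF that] assms(1) that Suc.prems(1)] by simp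
  qed (use Suc.prems in auto)
  then show ?case using g by auto
qed

text \<open>The recursion for \<open>Ck_on\<close> is stated with \<open>frechet_derivative\<close>, a choice; this rule lets one supply
  the derivative by a formula.\<close>

lemma Ck_on_SucI:
  assumes "open S" "\<And>x. x \<in> S \<Longrightarrow> (f has_derivative f' x) (at x)" "\<And>v. Ck_on n S (\<lambda>x. f' x v)"
  shows "Ck_on (Suc n) S f"
proof -
  have "Ck_on n S (\<lambda>x. frechet_derivative f (at x) v)" for v
    using frechet_derivative_at[OF assms(2)] by (intro Ck_on_cong[OF assms(1) _ assms(3)]) simp
  then show ?thesis using assms(2) by (auto simp: differentiable_def)
qed

lemma Ck_on_SucD: "Ck_on (Suc n) S f \<Longrightarrow> Ck_on n S f"
proof (induction n arbitrary: f)
  case 0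
  then show ?case
    by (simp add: continuous_at_imp_continuous_on differentiable_imp_continuous_within)
next
  case (Suc n)
  then show ?case by simp
qed

lemma Ck_on_has_derivative:
  "Ck_on (Suc n) S f \<Longrightarrow> x \<in> S \<Longrightarrow> (f has_derivative frechet_derivative f (at x)) (at x)"
  by (simp add: frechet_derivative_works[symmetric])

lemma Ck_on_const [simp]: "Ck_on n S (\<lambda>x. c)"
  by (induction n arbitrary: c) (auto simp: frechet_derivative_const)

lemma Ck_on_bounded_linear: "bounded_linear f \<Longrightarrow> Ck_on n S f"
proof (induction n)
  case 0
  then show ?case by (simp add: linear_continuous_on)
next
  case (Suc n)
  have "frechet_derivative f (at x) = f" for x
    using frechet_derivative_at[OF bounded_linear_imp_has_derivative[OF Suc.prems]] by simp
  then show ?case using Suc.prems by (simp add: bounded_linear_imp_differentiable)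
qed

lemma Ck_on_add:
  assumes "open S" "Ck_on n S f" "Ck_on n S g"
  shows "Ck_on n S (\<lambda>x. f x + g x)"
  using assms(2,3)
proof (induction n arbitrary: f g)
  case 0
  then show ?case by (simp add: continuous_on_add)
next
  case (Suc n)
  show ?case
    by (rule Ck_on_SucI[OF assms(1) has_derivative_add[OF Ck_on_has_derivative Ck_on_has_derivative]])
      (use Suc in \<open>auto intro!: Suc.IH\<close>)
qed

lemma Ck_on_bilinear:
  assumes "bounded_bilinear pr" "open S" "Ck_on n S f" "Ck_on n S g"
  shows "Ck_on n S (\<lambda>x. pr (f x) (g x))"
  using assms(3,4)
proof (induction n arbitrary: f g)
  case 0
  then show ?case by (simp add: bounded_bilinear.continuous_on[OF assms(1)])
next
  case (Suc n)
  show ?case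
  proof (rule Ck_on_SucI[OF assms(2) bounded_bilinear.FDERIV[OF assms(1) Ck_on_has_derivative Ck_on_has_derivative]])
    fix v
    show "Ck_on n S (\<lambda>x. pr (f x) (frechet_derivative g (at x) v) + pr (frechet_derivative f (at x) v) (g x))"
      using Suc.prems by (intro Ck_on_add[OF assms(2)] Suc.IH) (auto intro: Ck_on_SucD)
  qed (use Suc.prems in auto)
qed

lemma Ck_on_sum:
  assumes "open S" "finite I" "\<And>i. i \<in> I \<Longrightarrow> Ck_on n S (f i)"
  shows "Ck_on n S (\<lambda>x. \<Sum>i\<in>I. f i x)"
  using assms(2,3) by (induction I rule: finite_induct) (auto intro: Ck_on_add[OF assms(1)])

text \<open>The derivative \<open>Df (g x) (Dg x v)\<close> of a composite is not itself a composite. Expanding \<open>Dg x v\<close>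
  in a basis turns it into a sum of products of functions to which the induction hypothesis applies.\<close>

lemma Ck_on_compose:
  fixes f :: "'b::euclidean_space \<Rightarrow> 'c::real_normed_vector" and g :: "'a::real_normed_vector \<Rightarrow> 'b"
  assumes "open S" "open T" "Ck_on n T f" "Ck_on n S g" "g ` S \<subseteq> T"
  shows "Ck_on n S (\<lambda>x. f (g x))"
  using assms(3,4)
proof (induction n arbitrary: f)
  case 0
  then show ?case by (simp add: continuous_on_compose2[OF _ _ assms(5)])
next
  case (Suc n)
  note dg = Ck_on_has_derivative[OF Suc.prems(2)]
  have df: "(f has_derivative frechet_derivative f (at (g x))) (at (g x))" if "x \<in> S" for x
    using Ck_on_has_derivative[OF Suc.prems(1)] that assms(5) by blast
  let ?D = "\<lambda>x v. \<Sum>i\<in>Basis. (frechet_derivative g (at x) v \<bullet> i) *\<^sub>R frechet_derivative f (at (g x)) i"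
  have eq: "frechet_derivative f (at (g x)) (frechet_derivative g (at x) v) = ?D x v" if "x \<in> S" for x v
  proof -
    have "linear (frechet_derivative f (at (g x)))"
      using df[OF that] has_derivative_linear by blast
    then show ?thesis
      by (subst (1) euclidean_representation[symmetric])
        (simp add: linear_sum linear_cmul)
  qed
  show ?case
  proof (rule Ck_on_SucI[OF assms(1)])
    fix x assume x: "x \<in> S"
    show "((\<lambda>x. f (g x)) has_derivative ?D x) (at x)"
      using has_derivative_compose[OF dg[OF x] df[OF x]] by (simp add: eq[OF x])
  next
    fix v
    have 1: "Ck_on n S (\<lambda>x. frechet_derivative f (at (g x)) i)" for i
      by (rule Suc.IH) (use Suc.prems Ck_on_SucD in auto)
    have 2: "Ck_on n S (\<lambda>x. frechet_derivative g (at x) v \<bullet> i)" for i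
      by (rule Ck_on_bilinear[OF bounded_bilinear_inner assms(1)]) (use Suc.prems in auto)
    show "Ck_on n S (\<lambda>x. ?D x v)"
      by (intro Ck_on_sum[OF assms(1)] Ck_on_bilinear[OF bounded_bilinear_scaleR assms(1)] 1 2) auto
  qed
qed

lemma smooth_on_const: "smooth_on S (\<lambda>x. c)"
  unfolding smooth_on_def by simp

lemma smooth_on_bounded_linear: "bounded_linear f \<Longrightarrow> smooth_on S f"
  unfolding smooth_on_def using Ck_on_bounded_linear by blast

lemma smooth_on_add: "open S \<Longrightarrow> smooth_on S f \<Longrightarrow> smooth_on S g \<Longrightarrow> smooth_on S (\<lambda>x. f x + g x)"
  unfolding smooth_on_def using Ck_on_add by blast

lemma smooth_on_bilinear:
  "bounded_bilinear pr \<Longrightarrow> open S \<Longrightarrow> smooth_on S f \<Longrightarrow> smooth_on S g \<Longrightarrow> smooth_on S (\<lambda>x. pr (f x) (g x))"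
  unfolding smooth_on_def using Ck_on_bilinear by blast

lemmas smooth_on_scaleR = smooth_on_bilinear[OF bounded_bilinear_scaleR]
lemmas smooth_on_mult = smooth_on_bilinear[OF bounded_bilinear_mult]

lemma smooth_on_compose:
  fixes f :: "'b::euclidean_space \<Rightarrow> 'c::real_normed_vector" and g :: "'a::real_normed_vector \<Rightarrow> 'b"
  assumes "open S" "open T" "smooth_on T f" "smooth_on S g" "g ` S \<subseteq> T"
  shows "smooth_on S (\<lambda>x. f (g x))"
  using assms Ck_on_compose unfolding smooth_on_def by blast

lemma smooth_on_linear_compose:
  fixes g :: "'a::real_normed_vector \<Rightarrow> 'b::euclidean_space"
  assumes "open S" "bounded_linear f" "smooth_on S g"
  shows "smooth_on S (\<lambda>x. f (g x))"
  using smooth_on_compose[OF assms(1) open_UNIV smooth_on_bounded_linear[OF assms(2)] assms(3)] by simp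

lemma smooth_on_differentiable: "smooth_on S f \<Longrightarrow> x \<in> S \<Longrightarrow> f differentiable at x"
  unfolding smooth_on_def by (drule spec[of _ 1]) simp

lemma smooth_on_continuous_on: "smooth_on S f \<Longrightarrow> continuous_on S f"
  unfolding smooth_on_def by (drule spec[of _ 0]) simp

lemma smooth_on_minus: "open S \<Longrightarrow> smooth_on S f \<Longrightarrow> smooth_on S (\<lambda>x. - f x)"
  using smooth_on_scaleR[of S "\<lambda>x. -1" f] smooth_on_const[of S "-1::real"] by simp

lemma smooth_on_diff: "open S \<Longrightarrow> smooth_on S f \<Longrightarrow> smooth_on S g \<Longrightarrow> smooth_on S (\<lambda>x. f x - g x)"
  using smooth_on_add[of S f "\<lambda>x. - g x"] smooth_on_minus[of S g] by simp

lemma smooth_on_Pair: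
  fixes f :: "'a::real_normed_vector \<Rightarrow> 'b::euclidean_space" and g :: "'a \<Rightarrow> 'c::euclidean_space"
  assumes "open S" "smooth_on S f" "smooth_on S g"
  shows "smooth_on S (\<lambda>x. (f x, g x))"
proof -
  have "bounded_linear (\<lambda>y. (y, 0::'c))" "bounded_linear (\<lambda>z. (0::'b, z))"
    by (rule bounded_linear_Pair[OF bounded_linear_ident bounded_linear_zero]
        bounded_linear_Pair[OF bounded_linear_zero bounded_linear_ident])+
  then have "smooth_on S (\<lambda>x. (f x, 0::'c) + (0::'b, g x))"
    using assms by (intro smooth_on_add smooth_on_linear_compose[where f="\<lambda>y. (y, 0)"]
        smooth_on_linear_compose[where f="\<lambda>z. (0, z)"])
  then show ?thesis by simp
qed

lemma smooth_on_nth: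
  fixes f :: "'a::real_normed_vector \<Rightarrow> real^'n"
  shows "open S \<Longrightarrow> smooth_on S f \<Longrightarrow> smooth_on S (\<lambda>x. f x $ i)"
  by (rule smooth_on_linear_compose[OF _ bounded_linear_vec_nth])

lemma smooth_on_vec_nth: "smooth_on S (\<lambda>y::real^'n. y $ i)"
  by (rule smooth_on_bounded_linear[OF bounded_linear_vec_nth])

lemma vec3_eta: "vector [v$1, v$2, v$3] = (v :: 'a::zero^3)"
  by (simp add: vec_eq_iff forall_3)

lemma smooth_on_vector3:
  fixes f g h :: "'a::real_normed_vector \<Rightarrow> real"
  assumes "open S" "smooth_on S f" "smooth_on S g" "smooth_on S h"
  shows "smooth_on S (\<lambda>x. vector [f x, g x, h x] :: real^3)"
proof -
  have "smooth_on S (\<lambda>x. f x *\<^sub>R axis 1 1 + g x *\<^sub>R axis 2 1 + h x *\<^sub>R axis 3 (1::real) :: real^3)"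
    using assms by (intro smooth_on_add smooth_on_scaleR smooth_on_const)
  moreover have "f x *\<^sub>R axis 1 1 + g x *\<^sub>R axis 2 1 + h x *\<^sub>R axis 3 (1::real) = (vector [f x, g x, h x] :: real^3)" for x
    by (simp add: vec_eq_iff forall_3 axis_def)
  ultimately show ?thesis by simp
qed

lemma Ck_on_vector_derivative:
  fixes f :: "real \<Rightarrow> 'b::real_normed_vector"
  assumes "open S" "\<And>x. x \<in> S \<Longrightarrow> (f has_vector_derivative f' x) (at x)" "Ck_on n S f'"
  shows "Ck_on (Suc n) S f"
proof (rule Ck_on_SucI[OF assms(1)])
  show "(f has_derivative (\<lambda>h. h *\<^sub>R f' x)) (at x)" if "x \<in> S" for x
    using assms(2)[OF that] by (simp add: has_vector_derivative_def)
  show "Ck_on n S (\<lambda>x. v *\<^sub>R f' x)" for v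
    by (rule Ck_on_bilinear[OF bounded_bilinear_scaleR assms(1) Ck_on_const assms(3)])
qed

lemma smooth_on_vector_derivative:
  fixes f :: "real \<Rightarrow> 'b::real_normed_vector"
  assumes "open S" "\<And>x. x \<in> S \<Longrightarrow> (f has_vector_derivative f' x) (at x)" "smooth_on S f'"
  shows "smooth_on S f"
  unfolding smooth_on_def
proof
  fix n
  show "Ck_on n S f"
    using Ck_on_SucD[OF Ck_on_vector_derivative[OF assms(1,2)]] assms(3) by (simp add: smooth_on_def)
qed

text \<open>Induction on the order of differentiability for all members of the family at once. The exponential
  function is one example, the orbits of a linear flow are another.\<close>

lemma smooth_on_derivative_family:
  fixes f :: "'i \<Rightarrow> real \<Rightarrow> 'b::real_normed_vector"
  assumes "\<And>i t. (f i has_vector_derivative f (s i) t) (at t)"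
  shows "smooth_on UNIV (f i)"
proof -
  have "Ck_on n UNIV (f i)" for n
  proof (induction n arbitrary: i)
    case 0
    then show ?case
      using assms by (auto intro!: continuous_at_imp_continuous_on has_vector_derivative_continuous)
  next
    case (Suc n)
    show ?case using Ck_on_vector_derivative[OF open_UNIV assms Suc.IH] .
  qed
  then show ?thesis by (simp add: smooth_on_def)
qed

lemma smooth_on_exp: "smooth_on UNIV (exp :: real \<Rightarrow> real)"
  by (rule smooth_on_derivative_family[of "\<lambda>_::unit. exp :: real \<Rightarrow> real" "\<lambda>_. ()" "()"])
    (simp add: has_real_derivative_iff_has_vector_derivative[symmetric])

lemma smooth_on_inverse: "smooth_on {0<..} (inverse :: real \<Rightarrow> real)"
proof -
  have "Ck_on n {0<..} (inverse :: real \<Rightarrow> real)" for n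
  proof (induction n)
    case 0
    then show ?case by (auto intro!: continuous_intros)
  next
    case (Suc n)
    have d: "(inverse has_vector_derivative (-1) * (inverse x * inverse x)) (at x)" if "x \<in> {0<..}" for x :: real
      using DERIV_inverse[of x] that
      by (simp add: has_real_derivative_iff_has_vector_derivative power2_eq_square)
    show ?case
      by (rule Ck_on_vector_derivative[OF open_greaterThan d]; assumption?)
        (rule Ck_on_bilinear[OF bounded_bilinear_mult open_greaterThan Ck_on_const
            Ck_on_bilinear[OF bounded_bilinear_mult open_greaterThan Suc.IH Suc.IH]])
  qed
  then show ?thesis by (simp add: smooth_on_def)
qed

lemma smooth_on_ln: "smooth_on {0<..} (ln :: real \<Rightarrow> real)"
  by (rule smooth_on_vector_derivative[OF open_greaterThan _ smooth_on_inverse])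
    (simp add: has_real_derivative_iff_has_vector_derivative[symmetric] DERIV_ln)

text \<open>The chain rule makes the derivative injective, and an injective endomorphism of a
  finite-dimensional space is onto.\<close>

lemma surj_frechet_derivative_of_left_inverse:
  fixes f :: "'a::euclidean_space \<Rightarrow> 'a"
  assumes "open S" "x \<in> S" "f differentiable at x" "g differentiable at (f x)"
    "\<And>y. y \<in> S \<Longrightarrow> g (f y) = y"
  shows "surj (frechet_derivative f (at x))"
proof -
  note f = assms(3)[unfolded frechet_derivative_works]
  note g = assms(4)[unfolded frechet_derivative_works]
  have "((\<lambda>y. g (f y)) has_derivative (\<lambda>v. frechet_derivative g (at (f x)) (frechet_derivative f (at x) v))) (at x)"
    by (rule has_derivative_compose[OF f g])
  moreover have "((\<lambda>y. g (f y)) has_derivative (\<lambda>v. v)) (at x)"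
    by (rule has_derivative_transform_within_open[OF has_derivative_ident assms(1,2)]) (simp add: assms(5))
  ultimately have "(\<lambda>v. frechet_derivative g (at (f x)) (frechet_derivative f (at x) v)) = (\<lambda>v. v)"
    by (rule has_derivative_unique)
  then have "inj (frechet_derivative f (at x))" by (metis injI)
  then show ?thesis using linear_injective_imp_surjective has_derivative_linear[OF f] by blast
qed

lemma vector_derivative_eq_imp_eq:
  fixes f g :: "real \<Rightarrow> 'a::real_normed_vector"
  assumes "\<And>t. (f has_vector_derivative h t) (at t)" "\<And>t. (g has_vector_derivative h t) (at t)" "f 0 = g 0"
  shows "f t = g t"
proof -
  have "((\<lambda>t. f t - g t) has_vector_derivative 0) (at t)" for t
    using has_vector_derivative_diff[OF assms(1)[of t] assms(2)[of t]] by simp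
  then obtain c where c: "\<And>t. f t - g t = c"
    using has_vector_derivative_zero_constant[of UNIV "\<lambda>t. f t - g t"] by (metis UNIV_I convex_UNIV)
  then show ?thesis using c[of 0] c[of t] assms(3) by simp
qed

lemma antiderivative_vanishing_at_0:
  fixes f :: "real \<Rightarrow> 'a::euclidean_space"
  assumes "continuous_on UNIV f"
  obtains F where "\<And>t. (F has_vector_derivative f t) (at t)" "F 0 = 0"
proof -
  obtain M where M: "\<And>t. (M has_vector_derivative f t) (at t)"
    using einterval_antiderivative[of "-\<infinity>" \<infinity> f] assms
    by (auto simp: continuous_on_eq_continuous_at)
  have "((\<lambda>t. M t - M 0) has_vector_derivative f t) (at t)" for t
    using has_vector_derivative_diff[OF M has_vector_derivative_const] by simp
  then show ?thesis using that by fastforce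
qed

lemma has_vector_derivative_shift:
  assumes "\<And>t. (f has_vector_derivative f' t) (at t)"
  shows "((\<lambda>t. f (s + t)) has_vector_derivative f' (s + t)) (at t)"
proof -
  have "((\<lambda>t. s + t) has_vector_derivative 1) (at t)" by (auto intro!: derivative_eq_intros)
  from vector_diff_chain_at[OF this assms] show ?thesis by (simp add: o_def)
qed

section \<open>The Heisenberg algebra\<close>

lemma bracket_nth [simp]:
  "bracket v w $ 1 = v$2 * w$3 - v$3 * w$2" "bracket v w $ 2 = 0" "bracket v w $ 3 = 0"
  by (simp_all add: bracket_def heis_Z_def axis_def)

lemma heis_Z_nth [simp]: "heis_Z $ 1 = 1" "heis_Z $ 2 = 0" "heis_Z $ 3 = 0"
  by (simp_all add: heis_Z_def axis_def)

lemma heis_eqI: "v$1 = w$1 \<Longrightarrow> v$2 = w$2 \<Longrightarrow> v$3 = w$3 \<Longrightarrow> v = (w::heis)"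
  by (simp add: vec_eq_iff forall_3)

lemma heis_eq_iff: "v = w \<longleftrightarrow> v$1 = w$1 \<and> v$2 = w$2 \<and> v$3 = w$3" for v w :: heis
  by (simp add: vec_eq_iff forall_3)

abbreviation heis_X :: heis where "heis_X \<equiv> axis 2 1"
abbreviation heis_Y :: heis where "heis_Y \<equiv> axis 3 1"

lemma heis_XY_nth [simp]:
  "heis_X $ 1 = 0" "heis_X $ 2 = 1" "heis_X $ 3 = 0" "heis_Y $ 1 = 0" "heis_Y $ 2 = 0" "heis_Y $ 3 = 1"
  by (simp_all add: axis_def)

lemma heis_expansion: "v = v$1 *\<^sub>R heis_Z + v$2 *\<^sub>R heis_X + v$3 *\<^sub>R heis_Y"
  by (rule heis_eqI) auto

lemma bounded_bilinear_bracket: "bounded_bilinear bracket"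
proof -
  have "linear (bracket v)" "linear (\<lambda>v. bracket v w)" for v w
    by (rule linearI; rule heis_eqI; simp add: algebra_simps)+
  then have "bilinear bracket"
    by (simp add: bilinear_def)
  then show ?thesis by (simp add: bilinear_conv_bounded_bilinear)
qed
lemmas bracket_add_left = bounded_bilinear.add_left[OF bounded_bilinear_bracket]
lemmas bracket_add_right = bounded_bilinear.add_right[OF bounded_bilinear_bracket]
lemmas bracket_scaleR_left = bounded_bilinear.scaleR_left[OF bounded_bilinear_bracket]
lemmas bracket_scaleR_right = bounded_bilinear.scaleR_right[OF bounded_bilinear_bracket]

lemma bracket_central [simp]:
  "bracket (bracket u v) w = 0" "bracket w (bracket u v) = 0" "bracket heis_Z w = 0" "bracket w heis_Z = 0"
  by (rule heis_eqI; simp)+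

lemma bracket_zero [simp]: "bracket 0 w = 0" "bracket w 0 = 0" "bracket w w = 0"
  by (rule heis_eqI; simp)+

lemma bracket_XY: "bracket heis_X heis_Y = heis_Z"
  by (rule heis_eqI) auto

text \<open>The multiplication of \<open>Heis\<close> as a plain binary operation, free of the record syntax of groups.\<close>

definition heis_mult :: "heis \<Rightarrow> heis \<Rightarrow> heis" (infixl "\<odot>" 70) where
  "p \<odot> q = p + q + (1/2) *\<^sub>R bracket p q"

lemma heis_mult_nth [simp]:
  "(p \<odot> q) $ 1 = p$1 + q$1 + (p$2 * q$3 - p$3 * q$2) / 2"
  "(p \<odot> q) $ 2 = p$2 + q$2" "(p \<odot> q) $ 3 = p$3 + q$3"
  by (simp_all add: heis_mult_def)

lemma Heis_simps [simp]:
  "carrier Heis = UNIV" "p \<otimes>\<^bsub>Heis\<^esub> q = p \<odot> q" "\<one>\<^bsub>Heis\<^esub> = 0"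
  by (simp_all add: Heis_def heis_mult_def)

lemma heis_mult_assoc: "(p \<odot> q) \<odot> r = p \<odot> (q \<odot> r)"
  by (rule heis_eqI) (simp_all add: field_simps)

lemma heis_mult_unit [simp]: "p \<odot> 0 = p" "0 \<odot> p = p" "p \<odot> - p = 0" "- p \<odot> p = 0"
  by (rule heis_eqI; simp)+

lemma heis_mult_cancel [simp]: "- p \<odot> (p \<odot> q) = q" "p \<odot> (- p \<odot> q) = q"
  by (simp_all flip: heis_mult_assoc)

lemma smooth_on_bracket:
  "open S \<Longrightarrow> smooth_on S f \<Longrightarrow> smooth_on S g \<Longrightarrow> smooth_on S (\<lambda>x. bracket (f x) (g x))"
  by (rule smooth_on_bilinear[OF bounded_bilinear_bracket])

lemma smooth_on_heis_mult:
  "open S \<Longrightarrow> smooth_on S f \<Longrightarrow> smooth_on S g \<Longrightarrow> smooth_on S (\<lambda>x. f x \<odot> g x)"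
  unfolding heis_mult_def
  by (intro smooth_on_add smooth_on_scaleR smooth_on_const smooth_on_bracket)

section \<open>Continuous homomorphisms are linear\<close>

text \<open>Cauchy's functional equation: the two sides agree on the rationals, which are dense.\<close>

lemma continuous_additive_imp_scaleR:
  fixes f :: "real \<Rightarrow> 'b::real_normed_vector"
  assumes add: "\<And>s t. f (s + t) = f s + f t" and cont: "continuous_on UNIV f"
  shows "f t = t *\<^sub>R f 1"
proof -
  interpret f: additive f by unfold_locales (rule add)
  have nat: "f (of_nat n * t) = of_nat n *\<^sub>R f t" for n t
  proof (induction n)
    case (Suc n)
    then show ?case using add[of "of_nat n * t" t] by (simp add: algebra_simps)
  qed (simp add: f.zero)
  have int: "f (of_int k * t) = of_int k *\<^sub>R f t" for k t
    by (cases k rule: int_cases2) (simp_all add: nat f.minus)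
  have rat: "f q = q *\<^sub>R f 1" if qrat: "q \<in> \<rat>" for q
  proof -
    obtain a b where q: "q = of_int a / of_int b" "b > 0"
      using Rats_cases'[OF qrat] by metis
    have "of_int b *\<^sub>R f q = of_int b *\<^sub>R (q *\<^sub>R f 1)"
      using int[of b q] int[of a 1] q by simp
    then show ?thesis using q(2) by (simp only: scaleR_cancel_left) simp
  qed
  have "closed {t. f t = t *\<^sub>R f 1}"
    by (intro closed_Collect_eq cont continuous_intros)
  then have "closure \<rat> \<subseteq> {t. f t = t *\<^sub>R f 1}"
    using rat by (intro closure_minimal) blast+
  then show ?thesis using Rats_closure_real by blast
qed

text \<open>A homomorphism is additive on each line, because two elements of a line commute and so do
  their images; the bracket is the commutator of the group, so it is preserved as well.\<close>

lemma continuous_hom_linear: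
  assumes hom: "\<And>p q. T (p \<odot> q) = T p \<odot> T q" and cont: "continuous_on UNIV T"
  shows "linear T" "T (bracket v w) = bracket (T v) (T w)"
proof -
  have parallel: "T ((s + t) *\<^sub>R p) = T (s *\<^sub>R p) + T (t *\<^sub>R p)" for s t p
  proof -
    have *: "(s *\<^sub>R p) \<odot> (t *\<^sub>R p) = (s + t) *\<^sub>R p" for s t
      by (rule heis_eqI) (simp_all add: algebra_simps)
    have c: "T (s *\<^sub>R p) \<odot> T (t *\<^sub>R p) = T (t *\<^sub>R p) \<odot> T (s *\<^sub>R p)"
      unfolding hom[symmetric] * by (simp only: add.commute)
    have "bracket (T (s *\<^sub>R p)) (T (t *\<^sub>R p)) = 0"
      using c by (simp add: heis_eq_iff)
    then show ?thesis using hom[of "s *\<^sub>R p" "t *\<^sub>R p"] unfolding * by (simp add: heis_mult_def)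
  qed
  have scale: "T (t *\<^sub>R p) = t *\<^sub>R T p" for t p
  proof -
    have "continuous_on UNIV (\<lambda>t. T (t *\<^sub>R p))"
      by (rule continuous_on_compose2[OF cont]) (auto intro!: continuous_intros)
    from continuous_additive_imp_scaleR[OF parallel this] show ?thesis by simp
  qed
  have neg: "T (- p) = - T p" for p using scale[of "-1" p] by simp
  have br: "T (bracket p q) = bracket (T p) (T q)" for p q
  proof -
    \<comment> \<open>The bracket is the group commutator.\<close>
    have *: "bracket p q = p \<odot> q \<odot> (- p) \<odot> (- q)" for p q
      by (rule heis_eqI) (simp_all add: algebra_simps)
    show ?thesis unfolding * by (simp only: hom neg)
  qed
  have plus: "T (p + q) = T p + T q" for p q
  proof -
    have *: "p + q = p \<odot> q \<odot> (- (1/2)) *\<^sub>R bracket p q" for p q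
      by (rule heis_eqI) simp_all
    show ?thesis unfolding * by (simp only: hom scale br)
  qed
  show "linear T" by (rule linearI) (simp_all add: plus scale)
  show "T (bracket v w) = bracket (T v) (T w)" by (rule br)
qed

section \<open>One-parameter groups of automorphisms\<close>

text \<open>One-parameter groups of automorphisms of the Lie algebra, together with their generator. Only the
  derivative at time 0 is assumed; the group law moves it to all other times.\<close>

locale lie_flow =
  fixes \<rho> :: "real \<Rightarrow> heis \<Rightarrow> heis" and A :: "heis \<Rightarrow> heis"
  assumes linear: "linear (\<rho> t)"
    and bracket: "\<rho> t (bracket v w) = bracket (\<rho> t v) (\<rho> t w)"
    and add: "\<rho> (s + t) v = \<rho> s (\<rho> t v)"
    and zero [simp]: "\<rho> 0 v = v"
    and deriv_0: "((\<lambda>t. \<rho> t v) has_vector_derivative A v) (at 0)"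
begin

lemma bounded_linear: "bounded_linear (\<rho> t)"
  using linear linear_conv_bounded_linear by blast

lemmas lin_simps = linear_add[OF linear] linear_scale[OF linear] linear_neg[OF linear]
  linear_diff[OF linear] linear_0[OF linear]

lemma inverse [simp]: "\<rho> (- t) (\<rho> t v) = v" "\<rho> t (\<rho> (- t) v) = v"
  by (simp_all flip: add)

lemma mult: "\<rho> t (p \<odot> q) = \<rho> t p \<odot> \<rho> t q"
  by (simp add: heis_mult_def lin_simps bracket)

lemma deriv: "((\<lambda>t. \<rho> t v) has_vector_derivative \<rho> t (A v)) (at t)"
proof -
  have "((\<lambda>s. \<rho> t (\<rho> s v)) has_vector_derivative \<rho> t (A v)) (at (t + - t))"
    using bounded_linear.has_vector_derivative[OF bounded_linear deriv_0] by simp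
  then have "((\<lambda>s. \<rho> (t + s) v) has_vector_derivative \<rho> t (A v)) (at (t + - t))"
    by (simp add: add)
  moreover have "((\<lambda>s. s + - t) has_vector_derivative 1) (at t)"
    by (auto intro!: derivative_eq_intros)
  ultimately show ?thesis
    using vector_diff_chain_at[of "\<lambda>s. s + - t" 1 t "\<lambda>s. \<rho> (t + s) v"] by (simp add: o_def)
qed

lemma deriv_nth: "((\<lambda>t. \<rho> t v $ i) has_real_derivative \<rho> t (A v) $ i) (at t)"
  using bounded_linear.has_vector_derivative[OF bounded_linear_vec_nth deriv]
  by (simp add: has_real_derivative_iff_has_vector_derivative)

lemma A_unique: "((\<lambda>t. \<rho> t v) has_vector_derivative w) (at 0) \<Longrightarrow> w = A v"
  using deriv_0 vector_derivative_unique_at by blast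

lemma linear_A: "linear A"
proof (rule linearI)
  show "A (v + w) = A v + A w" for v w
    by (rule A_unique[symmetric]) (simp add: lin_simps has_vector_derivative_add deriv_0)
  show "A (c *\<^sub>R v) = c *\<^sub>R A v" for c v
    by (rule A_unique[symmetric])
      (simp add: lin_simps bounded_linear.has_vector_derivative[OF bounded_linear_scaleR_right deriv_0])
qed

lemma A_bracket: "A (bracket v w) = bracket (A v) w + bracket v (A w)"
  by (rule A_unique[symmetric], unfold bracket)
    (use bounded_bilinear.has_vector_derivative[OF bounded_bilinear_bracket deriv_0[of v] deriv_0[of w]]
      in \<open>simp add: add.commute\<close>)

lemma derivation_A: "derivation A"
  by (simp add: derivation_def linear_A A_bracket)

lemma commute: "A (\<rho> t v) = \<rho> t (A v)"
proof -
  have "((\<lambda>s. \<rho> s (\<rho> t v)) has_vector_derivative \<rho> t (A v)) (at 0)"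
    using bounded_linear.has_vector_derivative[OF bounded_linear deriv_0[of v], of t]
    by (simp flip: add add: add.commute)
  then show ?thesis using A_unique by metis
qed

lemma smooth_curve: "smooth_on UNIV (\<lambda>t. \<rho> t v)"
  by (rule smooth_on_derivative_family[of "\<lambda>v t. \<rho> t v" A]) (rule deriv)

lemma smooth_on_flow:
  fixes f :: "'a::real_normed_vector \<Rightarrow> real"
  assumes "open S" "smooth_on S f" "smooth_on S g"
  shows "smooth_on S (\<lambda>x. \<rho> (f x) (g x))"
proof -
  have "smooth_on S (\<lambda>x. \<rho> (f x) v)" for v
    using smooth_on_compose[OF assms(1) open_UNIV smooth_curve assms(2)] by simp
  then have "smooth_on S (\<lambda>x. g x $ 1 *\<^sub>R \<rho> (f x) heis_Z + g x $ 2 *\<^sub>R \<rho> (f x) heis_X + g x $ 3 *\<^sub>R \<rho> (f x) heis_Y)"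
    using assms by (intro smooth_on_add smooth_on_scaleR smooth_on_nth)
  moreover have "g x $ 1 *\<^sub>R \<rho> t heis_Z + g x $ 2 *\<^sub>R \<rho> t heis_X + g x $ 3 *\<^sub>R \<rho> t heis_Y = \<rho> t (g x)" for x t
    by (subst (4) heis_expansion) (simp add: lin_simps)
  ultimately show ?thesis by simp
qed

text \<open>The \<open>n\<close>-th derivative of \<open>\<lambda>t. \<rho> t v\<close> is the orbit of \<open>(A ^^ n) v\<close>, so Taylor's formula applies in each
  coordinate. On \<open>[-\<bar>t\<bar>, \<bar>t\<bar>]\<close> the flow is bounded by some \<open>C\<close>, which bounds the remainder by
  \<open>C * norm v * (\<bar>t\<bar> * K) ^ n / fact n\<close> with \<open>K\<close> a bound for \<open>A\<close>.\<close>

lemma generates: "generates A \<rho>"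
proof -
  have comp: "(\<lambda>n. (t ^ n / fact n) * (A ^^ n) v $ i) sums \<rho> t v $ i" for t v i
  proof -
    obtain K where K: "K > 0" "\<And>v. norm (A v) \<le> norm v * K"
      using bounded_linear.pos_bounded[OF linear_A[unfolded linear_conv_bounded_linear]] by blast
    have AK: "norm ((A ^^ n) v) \<le> norm v * K ^ n" for n
    proof (induction n)
      case (Suc n)
      have "norm ((A ^^ Suc n) v) \<le> norm ((A ^^ n) v) * K" using K by simp
      also have "\<dots> \<le> norm v * K ^ n * K" using Suc K by (simp add: mult_right_mono)
      finally show ?case by (simp add: mult_ac)
    qed simp
    have "compact ((\<lambda>(s, w). \<rho> s w) ` ({-\<bar>t\<bar>..\<bar>t\<bar>} \<times> cball 0 1))"
    proof (intro compact_continuous_image compact_Times compact_Icc compact_cball)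
      have "continuous_on UNIV (\<lambda>x. \<rho> (fst x) (snd x))"
        by (intro smooth_on_continuous_on smooth_on_flow open_UNIV smooth_on_bounded_linear
            bounded_linear_fst bounded_linear_snd)
      then show "continuous_on ({-\<bar>t\<bar>..\<bar>t\<bar>} \<times> cball 0 1) (\<lambda>(s, w). \<rho> s w)"
        by (auto simp: case_prod_unfold intro: continuous_on_subset)
    qed
    then obtain C where C: "\<And>s w. \<bar>s\<bar> \<le> \<bar>t\<bar> \<Longrightarrow> norm w \<le> 1 \<Longrightarrow> norm (\<rho> s w) \<le> C"
    proof -
      assume c: "compact ((\<lambda>(s, w). \<rho> s w) ` ({-\<bar>t\<bar>..\<bar>t\<bar>} \<times> cball 0 1))"
        and *: "\<And>C. (\<And>s w. \<bar>s\<bar> \<le> \<bar>t\<bar> \<Longrightarrow> norm w \<le> 1 \<Longrightarrow> norm (\<rho> s w) \<le> C) \<Longrightarrow> thesis"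
      obtain C where "\<forall>x \<in> (\<lambda>(s, w). \<rho> s w) ` ({-\<bar>t\<bar>..\<bar>t\<bar>} \<times> cball 0 1). norm x \<le> C"
        using compact_imp_bounded[OF c] unfolding bounded_iff by blast
      then have "norm (\<rho> s w) \<le> C" if "\<bar>s\<bar> \<le> \<bar>t\<bar>" "norm w \<le> 1" for s w
        using that by (simp add: ball_simps abs_le_iff)
      then show thesis by (rule *)
    qed
    have C2: "norm (\<rho> s w) \<le> C * norm w" if "\<bar>s\<bar> \<le> \<bar>t\<bar>" for s w
    proof (cases "w = 0")
      case False
      have "\<rho> s w = norm w *\<^sub>R \<rho> s ((1 / norm w) *\<^sub>R w)" using False by (simp add: lin_simps)
      then have "norm (\<rho> s w) = norm w * norm (\<rho> s ((1 / norm w) *\<^sub>R w))" by (metis norm_scaleR abs_norm_cancel)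
      also have "\<dots> \<le> norm w * C" using C[OF that, of "(1 / norm w) *\<^sub>R w"] False by (intro mult_left_mono) auto
      finally show ?thesis by (simp add: mult.commute)
    qed (simp add: lin_simps)
    have C0: "0 \<le> C" using C[of 0 0] by simp
    define diff where "diff n s = \<rho> s ((A ^^ n) v) $ i" for n s
    have bound: "\<bar>\<rho> t v $ i - (\<Sum>m<n. (t ^ m / fact m) * (A ^^ m) v $ i)\<bar> \<le> (C * norm v) * ((\<bar>t\<bar> * K) ^ n / fact n)" for n
    proof -
      obtain s where s: "\<bar>s\<bar> \<le> \<bar>t\<bar>" "\<rho> t v $ i = (\<Sum>m<n. (diff m 0 / fact m) * t ^ m) + (diff n s / fact n) * t ^ n"
      proof -
        have "diff 0 = (\<lambda>s. \<rho> s v $ i)" by (simp add: diff_def fun_eq_iff)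
        moreover have "\<forall>m x. DERIV (diff m) x :> diff (Suc m) x"
          using deriv_nth[of "(A ^^ _) v" i] unfolding diff_def by simp
        ultimately show ?thesis using Maclaurin_all_le[of diff "\<lambda>s. \<rho> s v $ i" t n] that by blast
      qed
      have "\<bar>\<rho> t v $ i - (\<Sum>m<n. (t ^ m / fact m) * (A ^^ m) v $ i)\<bar> = \<bar>diff n s\<bar> / fact n * \<bar>t\<bar> ^ n"
        unfolding s(2) by (simp add: diff_def abs_mult power_abs mult.commute)
      also have "\<bar>diff n s\<bar> \<le> norm (\<rho> s ((A ^^ n) v))" unfolding diff_def by (rule component_le_norm_cart)
      also have "\<dots> \<le> C * (norm v * K ^ n)"
        using C2[OF s(1), of "(A ^^ n) v"] mult_left_mono[OF AK C0] by (meson order_trans)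
      finally show ?thesis by (simp add: divide_right_mono mult_right_mono power_mult_distrib mult_ac)
    qed
    have "(\<lambda>n. (\<bar>t\<bar> * K) ^ n / fact n) \<longlonglongrightarrow> 0"
      using summable_LIMSEQ_zero[OF summable_exp[of "\<bar>t\<bar> * K"]] by (simp add: divide_inverse mult.commute)
    then have "(\<lambda>n. (C * norm v) * ((\<bar>t\<bar> * K) ^ n / fact n)) \<longlonglongrightarrow> 0"
      by (rule tendsto_mult_right_zero)
    then have "(\<lambda>n. \<rho> t v $ i - (\<Sum>m<n. (t ^ m / fact m) * (A ^^ m) v $ i)) \<longlonglongrightarrow> 0"
      by (rule Lim_null_comparison[rotated]) (intro always_eventually allI, use bound in simp)
    then have "(\<lambda>n. \<rho> t v $ i - (\<rho> t v $ i - (\<Sum>m<n. (t ^ m / fact m) * (A ^^ m) v $ i))) \<longlonglongrightarrow> \<rho> t v $ i - 0"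
      by (intro tendsto_diff tendsto_const)
    then show ?thesis by (simp add: sums_def)
  qed
  show ?thesis unfolding generates_def sums_def
    by (intro allI vec_tendstoI) (use comp in \<open>simp add: sums_def\<close>)
qed

end

text \<open>A continuous flow is differentiable: the vectors whose orbit is differentiable form a subspace
  that contains the integral \<open>M h\<close> of each orbit \<open>\<lambda>s. \<rho> s v\<close> over \<open>[0, h]\<close>, because \<open>\<rho> t (M h)\<close> is
  \<open>M (t + h) - M t\<close>. As \<open>M h / h\<close> tends to \<open>v\<close>, the subspace is dense; being finite-dimensional, it is
  closed.\<close>

lemma one_parameter_group_lie_flow:
  assumes "one_parameter_group \<rho>"
  shows "\<exists>A. lie_flow \<rho> A"
proof -
  have iso: "\<rho> t \<in> iso Heis Heis" and sum: "\<rho> (s + t) = \<rho> s \<circ> \<rho> t"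
    and cont: "continuous_on UNIV (\<lambda>(t, p). \<rho> t p)" for s t
    using assms by (auto simp: one_parameter_group_def)
  have hom: "\<rho> t (p \<odot> q) = \<rho> t p \<odot> \<rho> t q" for t p q
    using iso[of t] by (simp add: iso_def hom_def)
  have inj: "inj (\<rho> t)" for t using iso[of t] by (simp add: iso_def bij_betw_def)
  have ct: "continuous_on UNIV (\<rho> t)" for t
    using continuous_on_compose2[OF cont continuous_on_Pair[OF continuous_on_const continuous_on_id]] by simp
  have cv: "continuous_on UNIV (\<lambda>t. \<rho> t v)" for v
    using continuous_on_compose2[OF cont continuous_on_Pair[OF continuous_on_id continuous_on_const]] by simp
  note lin = continuous_hom_linear(1)[OF hom ct]
  have bl: "bounded_linear (\<rho> t)" for t using lin linear_conv_bounded_linear by blast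
  have zero: "\<rho> 0 v = v" for v
    using sum[of 0 0] inj[of 0] by (metis add_0 comp_apply injD)
  let ?D = "{v. \<exists>d. ((\<lambda>t. \<rho> t v) has_vector_derivative d) (at 0)}"
  have "subspace ?D"
  proof (rule subspaceI)
    show "0 \<in> ?D" using has_vector_derivative_const[of "0::heis" "at 0"] by (auto simp only: linear_0[OF lin])
    show "v + w \<in> ?D" if vw: "v \<in> ?D" "w \<in> ?D" for v w
    proof -
      obtain d e where "((\<lambda>t. \<rho> t v) has_vector_derivative d) (at 0)" "((\<lambda>t. \<rho> t w) has_vector_derivative e) (at 0)"
        using vw by blast
      from has_vector_derivative_add[OF this] show ?thesis by (auto simp only: linear_add[OF lin])
    qed
    show "c *\<^sub>R v \<in> ?D" if v: "v \<in> ?D" for c v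
    proof -
      obtain d where "((\<lambda>t. \<rho> t v) has_vector_derivative d) (at 0)" using v by blast
      from bounded_linear.has_vector_derivative[OF bounded_linear_scaleR_right[of c] this]
      show ?thesis by (auto simp only: linear_scale[OF lin])
    qed
  qed
  then have closed: "closed ?D" by (rule closed_subspace)
  have "v \<in> ?D" for v
  proof -
    obtain M where M: "\<And>t. (M has_vector_derivative \<rho> t v) (at t)" and M0: "M 0 = 0"
      using antiderivative_vanishing_at_0[OF cv] by blast
    note shift = has_vector_derivative_shift[OF M]
    have avg: "\<rho> t (M h) = M (t + h) - M t" for t h
    proof (rule vector_derivative_eq_imp_eq[where f = "\<lambda>h. \<rho> t (M h)" and h = "\<lambda>h. \<rho> (t + h) v"])
      show "((\<lambda>h. \<rho> t (M h)) has_vector_derivative \<rho> (t + h) v) (at h)" for h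
        using bounded_linear.has_vector_derivative[OF bl M] by (simp add: sum)
      show "((\<lambda>h. M (t + h) - M t) has_vector_derivative \<rho> (t + h) v) (at h)" for h
        using has_vector_derivative_diff[OF shift has_vector_derivative_const] by simp
    qed (simp add: M0 linear_0[OF lin])
    have "M h \<in> ?D" for h
    proof -
      have "((\<lambda>t. M (t + h) - M t) has_vector_derivative \<rho> (0 + h) v - \<rho> 0 v) (at 0)"
        using has_vector_derivative_diff[OF has_vector_derivative_shift[OF M, of h 0] M[of 0]] by (simp add: add.commute)
      then show ?thesis by (auto simp: avg)
    qed
    then have "(1/h) *\<^sub>R (M h) \<in> ?D" for h
      using \<open>subspace ?D\<close> subspace_scale by blast
    moreover have "((\<lambda>h. (1/h) *\<^sub>R (M h)) \<longlongrightarrow> v) (at 0)"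
    proof -
      have "((\<lambda>y. (M y - y *\<^sub>R v) /\<^sub>R norm y) \<longlongrightarrow> 0) (at 0)"
        using M[of 0] by (simp add: has_vector_derivative_def has_derivative_at_within zero M0)
      then have "((\<lambda>y. norm ((M y - y *\<^sub>R v) /\<^sub>R norm y)) \<longlongrightarrow> 0) (at 0)"
        by (rule tendsto_norm_zero)
      moreover have "norm ((M y - y *\<^sub>R v) /\<^sub>R norm y) = norm ((1/y) *\<^sub>R (M y) - v)" if "y \<noteq> 0" for y
      proof -
        have "(1/y) *\<^sub>R (M y) - v = (1/y) *\<^sub>R (M y - y *\<^sub>R v)"
          using that by (simp add: algebra_simps)
        then show ?thesis by (simp add: divide_inverse)
      qed
      ultimately have "((\<lambda>y. norm ((1/y) *\<^sub>R (M y) - v)) \<longlongrightarrow> 0) (at 0)"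
        by (rule Lim_transform_within[OF _ zero_less_one]) auto
      then show ?thesis by (rule LIM_zero_cancel[OF tendsto_norm_zero_cancel])
    qed
    ultimately show ?thesis
      by (intro Lim_in_closed_set[OF closed, of "\<lambda>h. (1/h) *\<^sub>R (M h)" "at 0"] always_eventually) auto
  qed
  then have "\<forall>v. \<exists>d. ((\<lambda>t. \<rho> t v) has_vector_derivative d) (at 0)" by blast
  then obtain A where "\<And>v. ((\<lambda>t. \<rho> t v) has_vector_derivative A v) (at 0)" by metis
  then have "lie_flow \<rho> A"
    using lin continuous_hom_linear(2)[OF hom ct] sum zero by (simp add: lie_flow_def)
  then show ?thesis by blast
qed

section \<open>The action on the centre\<close>

context lie_flow
begin

text \<open>The generator multiplies the centre, which is the derived algebra, by this number; \<open>\<rho>\<close> fixes the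
  centre pointwise iff it is 0.\<close>

definition rate :: real where "rate = A heis_Z $ 1"

lemma A_Z: "A heis_Z = rate *\<^sub>R heis_Z"
  using A_bracket[of heis_X heis_Y] by (intro heis_eqI) (simp_all add: rate_def bracket_XY)

lemma flow_Z: "\<rho> t heis_Z = exp (rate * t) *\<^sub>R heis_Z"
proof -
  have "((\<lambda>t. \<rho> t heis_Z $ 1 * exp (- rate * t)) has_real_derivative 0) (at t)" for t
    by (auto intro!: derivative_eq_intros deriv_nth simp: A_Z lin_simps)
  then have "\<rho> t heis_Z $ 1 * exp (- rate * t) = \<rho> 0 heis_Z $ 1 * exp (- rate * 0)"
    by (intro DERIV_isconst_all allI)
  then have "\<rho> t heis_Z $ 1 = exp (rate * t)" by (simp add: exp_minus field_simps)
  moreover have "\<rho> t heis_Z $ 2 = 0" "\<rho> t heis_Z $ 3 = 0"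
    by (simp_all add: bracket bracket_XY[symmetric] del: bracket_nth(1))
  ultimately show ?thesis by (intro heis_eqI) simp_all
qed

end

section \<open>Volume-preserving maps\<close>

text \<open>In the basis \<open>Z, X, Y\<close> the matrix is block triangular: the block of the centre is 1, and the
  determinant of the other block is the coefficient of \<open>Z\<close> in \<open>[T X, T Y] = [X, Y]\<close>.\<close>

lemma det_symplectic_fixing_center:
  assumes T: "linear T" "T heis_Z = heis_Z" "\<And>v w. bracket (T v) (T w) = bracket v w"
  shows "det (matrix T) = 1"
proof -
  have "bracket (T heis_X) (T heis_Y) $ 1 = 1" by (simp add: T(3))
  then show ?thesis using T(2) by (simp add: det_3 matrix_def heis_Z_def[symmetric] mult.commute)
qed

text \<open>On boxes this is the change of variables formula for the inverse linear map.\<close>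

lemma lborel_affine_det_1:
  fixes T :: "real^3 \<Rightarrow> real^3"
  assumes T: "linear T" "det (matrix T) = 1"
  shows "distr lborel borel (\<lambda>p. T p + k) = lborel"
proof (rule lborel_eqI[symmetric])
  have "invertible (matrix T)" using T by (simp add: invertible_det_nz)
  then have "bij T" using T by (metis invertible_eq_bij matrix_vector_mul(2) matrix_works ext)
  define T' where "T' = inv_into UNIV T"
  have lin': "linear T'" unfolding T'_def
    using T(1) \<open>bij T\<close> by (simp add: bij_is_inj bij_is_surj inj_linear_imp_inv_linear)
  have T': "T (T' x) = x" "T' (T x) = x" for x
    unfolding T'_def using \<open>bij T\<close> by (simp_all add: bij_is_surj surj_f_inv_f bij_is_inj)
  have "matrix (T' \<circ> T) = mat 1" using T' by (simp add: o_def matrix_id_mat_1 id_def[symmetric])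
  then have "matrix T' ** matrix T = mat 1" using matrix_compose[OF T(1) lin'] by simp
  then have det': "det (matrix T') = 1" using T(2) by (metis det_I det_mul mult.right_neutral)
  fix l u :: "real^3" assume le: "\<And>b. b \<in> Basis \<Longrightarrow> l \<bullet> b \<le> u \<bullet> b"
  have cont: "continuous_on UNIV (\<lambda>p. T p + k)"
    using T(1) by (intro continuous_intros linear_continuous_on) (simp add: linear_conv_bounded_linear)
  let ?S = "(\<lambda>p. T p + k) -` box l u"
  have "?S = T -` box (l - k) (u - k)"
    by (auto simp: mem_box inner_diff_left inner_add_left diff_less_eq less_diff_eq)
  then have S: "?S = T' ` box (l - k) (u - k)"
    unfolding T'_def by (simp only: bij_vimage_eq_inv_image[OF \<open>bij T\<close>])
  have opn: "open ?S" using cont open_box[of l u] by (simp add: continuous_on_open_vimage del: open_box)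
  have mb: "box (l - k) (u - k) \<in> lmeasurable" by simp
  have "emeasure (distr lborel borel (\<lambda>p. T p + k)) (box l u) = emeasure lborel ?S"
    using cont by (subst emeasure_distr) (auto simp: borel_measurable_continuous_onI)
  also have "\<dots> = emeasure lebesgue ?S" using opn by (simp add: emeasure_completion)
  also have "\<dots> = ennreal (measure lebesgue ?S)"
    unfolding S using measurable_linear_image[OF lin' mb] by (simp add: emeasure_eq_measure2)
  also have "measure lebesgue ?S = measure lebesgue (box (l - k) (u - k))"
    unfolding S by (subst measure_linear_image[OF lin' mb]) (simp add: det')
  also have "ennreal \<dots> = (\<Prod>b\<in>Basis. (u - l) \<bullet> b)"
    using le by (simp add: measure_completion measure_lborel_box_eq inner_diff_left)
  finally show "emeasure (distr lborel borel (\<lambda>p. T p + k)) (box l u) = (\<Prod>b\<in>Basis. (u - l) \<bullet> b)" .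
qed simp

text \<open>Fubini's theorem: each fibre is mapped to a fibre by a volume-preserving affine map, and the fibres
  are permuted by a translation of the line.\<close>

lemma lborel_fibrewise:
  fixes T :: "real \<Rightarrow> real^3 \<Rightarrow> real^3"
  assumes cont: "continuous_on UNIV (\<lambda>(s, p). (s + t, T s p + k s))"
    and T: "\<And>s. linear (T s)" "\<And>s. det (matrix (T s)) = 1"
  shows "distr lborel borel (\<lambda>(s, p). (s + t, T s p + k s)) = lborel"
proof (rule measure_eqI)
  let ?f = "\<lambda>(s, p). (s + t, T s p + k s)"
  fix B assume "B \<in> sets (distr lborel borel ?f)"
  then have B: "B \<in> sets (borel :: (real \<times> (real^3)) measure)" by simp
  have f: "?f \<in> borel_measurable borel" using cont by (rule borel_measurable_continuous_onI)
  have sections: "emeasure lborel C = (\<integral>\<^sup>+s. emeasure lborel (Pair s -` C) \<partial>lborel)"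
    if "C \<in> sets borel" for C :: "(real \<times> (real^3)) set"
  proof -
    have "C \<in> sets (lborel \<Otimes>\<^sub>M lborel)" using that by (simp only: lborel_prod sets_lborel)
    from lborel.emeasure_pair_measure_alt[OF this] show ?thesis by (simp only: lborel_prod)
  qed
  let ?g = "\<lambda>s. emeasure lborel (Pair s -` B)"
  have g: "?g \<in> borel_measurable borel"
    using lborel.measurable_emeasure_Pair[of B lborel] B by (simp add: borel_prod lborel_prod)
  have PB: "Pair s -` B \<in> sets borel" for s
  proof -
    have "B \<in> sets (lborel \<Otimes>\<^sub>M lborel)" using B by (simp only: lborel_prod sets_lborel)
    from sets_Pair1[OF this] show ?thesis by simp
  qed
  have "emeasure (distr lborel borel ?f) B = emeasure lborel (?f -` B)"
    using B f by (subst emeasure_distr) auto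
  also have "\<dots> = (\<integral>\<^sup>+s. emeasure lborel (Pair s -` (?f -` B)) \<partial>lborel)"
    using measurable_sets[OF f B] by (intro sections) simp
  also have "\<dots> = (\<integral>\<^sup>+s. ?g (t + 1 * s) \<partial>lborel)"
  proof (rule nn_integral_cong)
    fix s
    have c: "(\<lambda>p. T s p + k s) \<in> borel_measurable borel"
      using T(1)[of s] by (intro borel_measurable_continuous_onI continuous_intros linear_continuous_on)
        (simp add: linear_conv_bounded_linear)
    have "emeasure lborel (Pair s -` (?f -` B)) = emeasure (distr lborel borel (\<lambda>p. T s p + k s)) (Pair (s + t) -` B)"
      using c PB[of "s + t"] by (subst emeasure_distr) (auto simp: vimage_def)
    then show "emeasure lborel (Pair s -` (?f -` B)) = ?g (t + 1 * s)"
      unfolding lborel_affine_det_1[OF T] by (simp add: add.commute)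
  qed
  also have "\<dots> = (\<integral>\<^sup>+s. ?g s \<partial>lborel)"
    using nn_integral_real_affine[OF g, of 1 t] by simp
  also have "\<dots> = emeasure lborel B" by (rule sections[OF B, symmetric])
  finally show "emeasure (distr lborel borel ?f) B = emeasure lborel B" .
qed simp

section \<open>The groups \<open>G\<^sub>\<rho>\<close> and their unimodularity\<close>

lemma G_rho_simps [simp]:
  "carrier (G_rho \<rho>) = UNIV" "(s, p) \<otimes>\<^bsub>G_rho \<rho>\<^esub> (t, q) = (s + t, p \<odot> \<rho> s q)" "\<one>\<^bsub>G_rho \<rho>\<^esub> = (0, 0)"
  by (simp_all add: G_rho_def)

context lie_flow
begin

lemma group_G_rho: "group (G_rho \<rho>)"
proof (rule groupI)
  show "\<exists>y\<in>carrier (G_rho \<rho>). y \<otimes>\<^bsub>G_rho \<rho>\<^esub> x = \<one>\<^bsub>G_rho \<rho>\<^esub>" for x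
    by (cases x) (auto intro!: exI[of _ "- fst x"] exI[of _ "- \<rho> (- fst x) (snd x)"])
qed (auto simp: mult heis_mult_assoc add lin_simps)

lemma smooth_on_G_mult:
  assumes "open S" "smooth_on S f" "smooth_on S g"
  shows "smooth_on S (\<lambda>x. f x \<otimes>\<^bsub>G_rho \<rho>\<^esub> g x)"
proof -
  have "smooth_on S (\<lambda>x. (fst (f x) + fst (g x), snd (f x) \<odot> \<rho> (fst (f x)) (snd (g x))))"
    using assms by (intro smooth_on_Pair smooth_on_add smooth_on_heis_mult smooth_on_flow
        smooth_on_linear_compose[OF _ bounded_linear_fst] smooth_on_linear_compose[OF _ bounded_linear_snd])
  then show ?thesis by (simp add: G_rho_def heis_mult_def Heis_def case_prod_unfold)
qed

text \<open>Lebesgue measure is invariant under both kinds of translation. They shift the first coordinate and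
  act on the second by affine maps with linear part \<open>\<rho> t\<close> or the identity, up to an added bracket.
  These linear parts fix \<open>Z\<close> and preserve the bracket of any two vectors, so their determinant is 1.\<close>

lemma unimodular_if_rate_0:
  assumes "rate = 0"
  shows "unimodular (G_rho \<rho>)"
  unfolding unimodular_def
proof (intro exI[of _ lborel] conjI allI)
  have Z: "\<rho> t heis_Z = heis_Z" for t by (simp add: flow_Z assms)
  have sympl: "bracket (\<rho> t v) (\<rho> t w) = bracket v w" for t v w
  proof -
    have "\<rho> t (bracket v w) = bracket v w" by (simp add: bracket_def lin_simps Z)
    then show ?thesis by (simp add: bracket)
  qed
  note [simp] = bracket_add_left bracket_add_right bracket_scaleR_left bracket_scaleR_right
  fix g :: "real \<times> heis"
  obtain t q where g: "g = (t, q)" by (cases g)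
  define L where "L v = \<rho> t v + (1/2) *\<^sub>R bracket q (\<rho> t v)" for v
  have L: "linear L" "det (matrix L) = 1"
  proof -
    show "linear L" unfolding L_def by (rule linearI) (simp_all add: lin_simps algebra_simps)
    show "det (matrix L) = 1"
      by (rule det_symplectic_fixing_center[OF \<open>linear L\<close>]) (simp_all add: L_def Z sympl)
  qed
  define R where "R s v = v + (1/2) *\<^sub>R bracket v (\<rho> s q)" for s v
  have R: "linear (R s)" "det (matrix (R s)) = 1" for s
  proof -
    show "linear (R s)" unfolding R_def by (rule linearI) (simp_all add: algebra_simps)
    then show "det (matrix (R s)) = 1"
      by (rule det_symplectic_fixing_center) (simp_all add: R_def)
  qed
  have left: "(\<lambda>x. g \<otimes>\<^bsub>G_rho \<rho>\<^esub> x) = (\<lambda>(s, p). (s + t, L p + q))"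
    by (auto simp: fun_eq_iff g L_def heis_mult_def)
  have right: "(\<lambda>x. x \<otimes>\<^bsub>G_rho \<rho>\<^esub> g) = (\<lambda>(s, p). (s + t, R s p + \<rho> s q))"
    by (auto simp: fun_eq_iff g R_def heis_mult_def)
  have id: "smooth_on UNIV (\<lambda>x::real \<times> heis. x)" by (rule smooth_on_bounded_linear[OF bounded_linear_ident])
  have cl: "continuous_on UNIV (\<lambda>x. g \<otimes>\<^bsub>G_rho \<rho>\<^esub> x)" and cr: "continuous_on UNIV (\<lambda>x. x \<otimes>\<^bsub>G_rho \<rho>\<^esub> g)"
    by (intro smooth_on_continuous_on smooth_on_G_mult smooth_on_const id open_UNIV)+
  show "distr lborel borel (\<lambda>x. g \<otimes>\<^bsub>G_rho \<rho>\<^esub> x) = lborel"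
    using cl unfolding left by (rule lborel_fibrewise) (rule L)+
  show "distr lborel borel (\<lambda>x. x \<otimes>\<^bsub>G_rho \<rho>\<^esub> g) = lborel"
    using cr unfolding right by (rule lborel_fibrewise) (rule R)+
qed (auto simp: emeasure_compact_finite[unfolded infinity_ennreal_def])

end

section \<open>Normal form of the generator\<close>

lemma normal_form_nth [simp]:
  "(normal_form b *v v) $ 1 = v$1" "(normal_form b *v v) $ 2 = v$3" "(normal_form b *v v) $ 3 = b * v$2 + v$3"
  by (simp_all add: normal_form_def matrix_vector_mult_def sum_3 vector_3)

lemma linear_heis_expansion:
  assumes "linear T"
  shows "T v = v$1 *\<^sub>R T heis_Z + v$2 *\<^sub>R T heis_X + v$3 *\<^sub>R T heis_Y"
  by (subst heis_expansion) (simp add: linear_add[OF assms] linear_scale[OF assms])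

text \<open>An automorphism scales the centre by its determinant modulo the centre.\<close>

lemma lie_automorphism_Z:
  assumes "lie_automorphism \<phi>"
  shows "\<phi> heis_Z = (\<phi> heis_X $ 2 * \<phi> heis_Y $ 3 - \<phi> heis_X $ 3 * \<phi> heis_Y $ 2) *\<^sub>R heis_Z"
    and "\<phi> heis_X $ 2 * \<phi> heis_Y $ 3 - \<phi> heis_X $ 3 * \<phi> heis_Y $ 2 \<noteq> 0"
proof -
  have lin: "linear \<phi>" and inj: "inj \<phi>" and br: "\<phi> (bracket v w) = bracket (\<phi> v) (\<phi> w)" for v w
    using assms by (auto simp: lie_automorphism_def bij_def)
  show eq: "\<phi> heis_Z = (\<phi> heis_X $ 2 * \<phi> heis_Y $ 3 - \<phi> heis_X $ 3 * \<phi> heis_Y $ 2) *\<^sub>R heis_Z"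
    by (rule heis_eqI) (simp_all add: br bracket_XY[symmetric])
  have "\<phi> heis_Z \<noteq> 0"
    using inj linear_0[OF lin] heis_Z_nth(1) by (metis injD zero_index zero_neq_one)
  then show "\<phi> heis_X $ 2 * \<phi> heis_Y $ 3 - \<phi> heis_X $ 3 * \<phi> heis_Y $ 2 \<noteq> 0"
    using eq by auto
qed

text \<open>The derivative at 0 of the exponential series is its linear coefficient.\<close>

lemma lie_flow_generator_unique:
  assumes "lie_flow \<rho> A" "generates B \<rho>"
  shows "B = A"
proof
  fix v
  interpret lie_flow \<rho> A by fact
  show "B v = A v"
  proof (rule A_unique)
    have comp: "((\<lambda>t. \<rho> t v $ i) has_real_derivative B v $ i) (at 0)" for i
    proof -
      define c where "c n = (B ^^ n) v $ i / fact n" for n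
      have s: "(\<lambda>n. c n * t ^ n) sums (\<rho> t v $ i)" for t
        using bounded_linear.sums[OF bounded_linear_vec_nth[of i] assms(2)[unfolded generates_def, rule_format, of t v]]
        by (simp add: c_def mult.commute)
      have "((\<lambda>t. \<Sum>n. c n * t ^ n) has_field_derivative (\<Sum>n. diffs c n * 0 ^ n)) (at 0)"
        using s by (intro termdiffs_strong_converges_everywhere) (auto simp: sums_iff)
      moreover have "(\<Sum>n. diffs c n * 0 ^ n) = B v $ i"
        by (subst powser_zero) (simp add: diffs_def c_def)
      moreover have "(\<lambda>t. \<Sum>n. c n * t ^ n) = (\<lambda>t. \<rho> t v $ i)"
        using s by (auto simp: sums_iff)
      ultimately show ?thesis by simp
    qed
    have "((\<lambda>t. \<rho> t v $ 1 *\<^sub>R heis_Z + \<rho> t v $ 2 *\<^sub>R heis_X + \<rho> t v $ 3 *\<^sub>R heis_Y) has_vector_derivative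
        (B v $ 1 *\<^sub>R heis_Z + B v $ 2 *\<^sub>R heis_X + B v $ 3 *\<^sub>R heis_Y)) (at 0)"
      by (intro has_vector_derivative_add)
        (rule bounded_linear.has_vector_derivative[OF bounded_linear_scaleR_left
            comp[unfolded has_real_derivative_iff_has_vector_derivative]])+
    then show "((\<lambda>t. \<rho> t v) has_vector_derivative B v) (at 0)"
      by (simp flip: heis_expansion)
  qed
qed

lemma lie_flow_unique:
  assumes "lie_flow \<rho> A" "lie_flow \<sigma> A"
  shows "\<rho> = \<sigma>"
proof (intro ext)
  fix t v
  show "\<rho> t v = \<sigma> t v"
    using lie_flow.generates[OF assms(1), unfolded generates_def, rule_format]
      lie_flow.generates[OF assms(2), unfolded generates_def, rule_format] by (rule sums_unique2)
qed

text \<open>On the centre \<open>ad w\<close> vanishes and conjugation has no effect, so comparing the actions there forces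
  \<open>\<alpha> = 1 / rate\<close>. Modulo the centre \<open>ad w\<close> vanishes and \<open>\<phi>\<close> conjugates \<open>\<alpha> *\<^sub>R A\<close> to a 2 by 2 matrix with
  determinant \<open>-b\<close>.\<close>

lemma (in lie_flow) has_normal_form_eq:
  assumes "rate \<noteq> 0" "has_normal_form \<rho> b"
  shows "b = - (A heis_X $ 2 * A heis_Y $ 3 - A heis_X $ 3 * A heis_Y $ 2) / rate\<^sup>2"
proof -
  obtain A' \<alpha> w \<phi> where "generates A' \<rho>" and \<phi>: "lie_automorphism \<phi>"
    and eq: "\<And>v. \<phi> (\<alpha> *\<^sub>R A' v + bracket w v) = normal_form b *v \<phi> v"
    using assms(2) unfolding has_normal_form_def by blast
  then have [simp]: "A' = A" using lie_flow_generator_unique lie_flow_axioms by blast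
  have lin: "linear \<phi>" using \<phi> by (simp add: lie_automorphism_def)
  note Z = lie_automorphism_Z[OF \<phi>]
  \<comment> \<open>The entries of \<open>\<phi>\<close> modulo the centre; those of \<open>A\<close> will be \<open>a, c, d, e\<close>.\<close>
  define p q r s where pqrs: "p = \<phi> heis_X $ 2" "q = \<phi> heis_Y $ 2" "r = \<phi> heis_X $ 3" "s = \<phi> heis_Y $ 3"
  have comp: "\<phi> v $ 2 = v$2 * p + v$3 * q" "\<phi> v $ 3 = v$2 * r + v$3 * s" for v
    by (subst linear_heis_expansion[OF lin], simp add: Z(1) pqrs)+
  have "\<phi> (\<alpha> *\<^sub>R A heis_Z) = \<phi> heis_Z"
    using eq[of heis_Z] by (simp add: Z(1) heis_eq_iff)
  then have "\<alpha> * rate = 1"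
    using Z by (simp add: A_Z linear_scale[OF lin] heis_eq_iff)
  then have \<alpha>: "\<alpha> = 1 / rate" using assms(1) by (simp add: field_simps)
  define a c d e where acde: "a = A heis_X $ 2" "c = A heis_Y $ 2" "d = A heis_X $ 3" "e = A heis_Y $ 3"
  have 1: "\<alpha> * (p * a + q * d) = r" "\<alpha> * (r * a + s * d) = b * p + r"
    using eq[of heis_X] by (simp_all add: heis_eq_iff comp) (simp_all add: pqrs acde algebra_simps)
  have 2: "\<alpha> * (p * c + q * e) = s" "\<alpha> * (r * c + s * e) = b * q + s"
    using eq[of heis_Y] by (simp_all add: heis_eq_iff comp) (simp_all add: pqrs acde algebra_simps)
  have "(p * s - r * q) * (\<alpha>\<^sup>2 * (a * e - d * c) + b) = 0"
  proof -
    have "(\<alpha> * (p * a + q * d)) * (\<alpha> * (r * c + s * e)) - (\<alpha> * (p * c + q * e)) * (\<alpha> * (r * a + s * d))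
        = r * (b * q + s) - s * (b * p + r)"
      by (simp only: 1 2)
    then show ?thesis by (simp add: algebra_simps power2_eq_square)
  qed
  moreover have "p * s - r * q \<noteq> 0" using Z(2) by (simp add: pqrs)
  ultimately have "b = - (\<alpha>\<^sup>2 * (a * e - d * c))" by simp
  then show ?thesis by (simp add: \<alpha> acde power_divide minus_divide_left)
qed

text \<open>If \<open>A W\<close> were a multiple \<open>c\<close> of \<open>W\<close> modulo the centre, then \<open>\<rho> t W\<close> would be \<open>exp (c * t)\<close> times \<open>W\<close>
  modulo the centre, for all \<open>t\<close>.\<close>

lemma (in lie_flow) admissible_cyclic:
  assumes "admissible \<rho> W"
  shows "bracket W (A W) \<noteq> 0"
proof
  assume dep: "bracket W (A W) = 0"
  obtain v where "bracket W v \<noteq> 0" using assms by (auto simp: admissible_def)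
  then have "W$2 \<noteq> 0 \<or> W$3 \<noteq> 0" by (auto simp: heis_eq_iff)
  then obtain c where c: "A W $ 2 = c * W$2" "A W $ 3 = c * W$3"
  proof
    assume "W$2 \<noteq> 0"
    then show ?thesis using dep that[of "A W $ 2 / W$2"] by (simp add: heis_eq_iff field_simps)
  next
    assume "W$3 \<noteq> 0"
    then show ?thesis using dep that[of "A W $ 3 / W$3"] by (simp add: heis_eq_iff field_simps)
  qed
  have AW: "A W = c *\<^sub>R W + (A W $ 1 - c * W$1) *\<^sub>R heis_Z"
    using c by (intro heis_eqI) simp_all
  have "\<rho> t W $ i = exp (c * t) * W $ i" if i: "i = 2 \<or> i = 3" for t i
  proof -
    have "((\<lambda>t. \<rho> t W $ i * exp (- c * t)) has_real_derivative 0) (at t)" for t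
    proof -
      have "\<rho> t (A W) $ i = c * \<rho> t W $ i"
        using i by (subst AW) (auto simp: lin_simps flow_Z)
      then show ?thesis by (auto intro!: derivative_eq_intros deriv_nth)
    qed
    then have "\<rho> t W $ i * exp (- c * t) = \<rho> 0 W $ i * exp (- c * 0)"
      by (intro DERIV_isconst_all allI)
    then show ?thesis by (simp add: exp_minus field_simps)
  qed
  then have "\<rho> t W - exp (c * t) *\<^sub>R W = (\<rho> t W $ 1 - exp (c * t) * W$1) *\<^sub>R heis_Z" for t
    by (intro heis_eqI) simp_all
  then have "\<rho> t W - exp (c * t) *\<^sub>R W \<in> span {heis_Z}" for t
    by (metis span_base span_scale insertI1)
  then show False using assms by (auto simp: admissible_def)
qed

lemma (in lie_flow) trace_eq_rate: "A heis_X $ 2 + A heis_Y $ 3 = rate"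
  using A_bracket[of heis_X heis_Y] by (simp add: bracket_XY A_Z heis_eq_iff)

text \<open>Let \<open>B\<close> be \<open>A\<close> divided by its rate, so that \<open>B\<close> has trace 1 modulo the centre. With \<open>W\<close> as the third
  basis vector, the relation \<open>B Y = X + Y\<close> forces \<open>X0 = B W - W\<close>, and then the Cayley-Hamilton theorem
  gives \<open>B X0 = b *\<^sub>R W\<close> modulo the centre, with \<open>-b\<close> the determinant. The central error \<open>x\<close> is
  cancelled by \<open>ad w\<close> with \<open>w\<close> a multiple of \<open>W\<close>, which does not disturb \<open>B W\<close>.\<close>

lemma (in lie_flow) normal_form_basis:
  assumes "rate \<noteq> 0" "bracket W (A W) \<noteq> 0"
  obtains b w \<psi> where "lie_automorphism \<psi>" "\<psi> heis_Y = W"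
    "\<And>v. \<psi> (normal_form b *v v) = (1 / rate) *\<^sub>R A (\<psi> v) + bracket w (\<psi> v)"
proof -
  define B where "B v = (1 / rate) *\<^sub>R A v" for v
  define b where "b = - (A heis_X $ 2 * A heis_Y $ 3 - A heis_X $ 3 * A heis_Y $ 2) / rate\<^sup>2"
  define X0 where "X0 = B W - W"
  define \<zeta> where "\<zeta> = X0$2 * W$3 - X0$3 * W$2"
  have linB: "linear B" unfolding B_def using linear_A linear_compose_scale_right by blast
  have BZ: "B heis_Z = heis_Z" using assms(1) by (simp add: B_def A_Z)
  have comp: "B v $ 2 = v$2 * B heis_X $ 2 + v$3 * B heis_Y $ 2" "B v $ 3 = v$2 * B heis_X $ 3 + v$3 * B heis_Y $ 3" for v
    by (subst linear_heis_expansion[OF linB], simp add: BZ)+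
  have tr: "B heis_X $ 2 + B heis_Y $ 3 = 1"
    using trace_eq_rate assms(1) by (simp add: B_def add_divide_distrib[symmetric])
  have b: "b = - (B heis_X $ 2 * B heis_Y $ 3 - B heis_X $ 3 * B heis_Y $ 2)"
    by (simp add: b_def B_def power2_eq_square diff_divide_distrib)
  have \<zeta>: "\<zeta> \<noteq> 0"
    using assms by (simp add: \<zeta>_def X0_def B_def heis_eq_iff field_simps)
  have br0: "bracket X0 W = \<zeta> *\<^sub>R heis_Z" by (rule heis_eqI) (simp_all add: \<zeta>_def)
  define x where "x = (B X0 - b *\<^sub>R W) $ 1"
  have BX0: "B X0 = b *\<^sub>R W + x *\<^sub>R heis_Z"
  proof (rule heis_eqI)
    have t: "B heis_X $ 2 = 1 - B heis_Y $ 3" using tr by simp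
    show "B X0 $ 2 = (b *\<^sub>R W + x *\<^sub>R heis_Z) $ 2" "B X0 $ 3 = (b *\<^sub>R W + x *\<^sub>R heis_Z) $ 3"
      unfolding comp[of X0] by (simp_all add: X0_def comp[of W] b t algebra_simps)
  qed (simp add: x_def)
  define \<psi> :: "heis \<Rightarrow> heis" where "\<psi> v = (v$1 * \<zeta>) *\<^sub>R heis_Z + v$2 *\<^sub>R X0 + v$3 *\<^sub>R W" for v
  have lin: "linear \<psi>" unfolding \<psi>_def by (rule linearI) (simp_all add: algebra_simps)
  have br: "\<psi> (bracket v w) = bracket (\<psi> v) (\<psi> w)" for v w
    by (rule heis_eqI) (simp_all add: \<psi>_def \<zeta>_def algebra_simps)
  have "inj \<psi>"
  proof (rule linear_injective_0[OF lin, THEN iffD2, rule_format])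
    fix v assume v: "\<psi> v = 0"
    have "bracket (\<psi> v) W = (v$2 * \<zeta>) *\<^sub>R heis_Z" "bracket X0 (\<psi> v) = (v$3 * \<zeta>) *\<^sub>R heis_Z"
      by (simp_all add: \<psi>_def bracket_add_left bracket_add_right bracket_scaleR_left bracket_scaleR_right br0)
    then have "v$2 = 0" "v$3 = 0" using v \<zeta> by (simp_all add: heis_eq_iff)
    moreover from this have "v$1 = 0" using v \<zeta> by (simp add: \<psi>_def heis_eq_iff)
    ultimately show "v = 0" by (simp add: heis_eq_iff)
  qed
  then have "bij \<psi>" using linear_injective_imp_surjective[OF lin] by (simp add: bij_def)
  then have aut: "lie_automorphism \<psi>" using lin br by (simp add: lie_automorphism_def)
  define w where "w = (x / \<zeta>) *\<^sub>R W"
  have "\<psi> (normal_form b *v v) = (1 / rate) *\<^sub>R A (\<psi> v) + bracket w (\<psi> v)" for v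
  proof -
    have [simp]: "bracket W X0 = - \<zeta> *\<^sub>R heis_Z" by (rule heis_eqI) (simp_all add: \<zeta>_def)
    have "(1 / rate) *\<^sub>R A (\<psi> v) = B (\<psi> v)" by (simp add: B_def)
    moreover have "\<dots> = (v$1 * \<zeta>) *\<^sub>R heis_Z + v$2 *\<^sub>R (b *\<^sub>R W + x *\<^sub>R heis_Z) + v$3 *\<^sub>R (X0 + W)"
      by (simp add: \<psi>_def linear_add[OF linB] linear_scale[OF linB] BZ BX0) (simp add: X0_def)
    moreover have "bracket w (\<psi> v) = (- v$2 * x) *\<^sub>R heis_Z"
      using \<zeta> by (simp add: \<psi>_def w_def bracket_add_right bracket_scaleR_right bracket_scaleR_left)
    ultimately show ?thesis
      by (simp add: \<psi>_def algebra_simps)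
  qed
  moreover have "\<psi> heis_Y = W" by (simp add: \<psi>_def)
  ultimately show ?thesis using that aut by blast
qed

lemma lie_automorphism_inverse:
  assumes "lie_automorphism \<psi>"
  obtains \<phi> where "lie_automorphism \<phi>" "\<And>v. \<phi> (\<psi> v) = v" "\<And>v. \<psi> (\<phi> v) = v"
proof -
  let ?\<phi> = "inv_into UNIV \<psi>"
  have lin: "linear \<psi>" and bij: "bij \<psi>" and br: "\<psi> (bracket v w) = bracket (\<psi> v) (\<psi> w)" for v w
    using assms by (auto simp: lie_automorphism_def)
  have i: "?\<phi> (\<psi> v) = v" "\<psi> (?\<phi> v) = v" for v
    using bij by (simp_all add: bij_is_inj bij_is_surj surj_f_inv_f)
  moreover have "?\<phi> (bracket v w) = bracket (?\<phi> v) (?\<phi> w)" for v w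
    by (metis br i)
  moreover have "linear ?\<phi>" by (rule linearI) (metis i linear_add[OF lin], metis i linear_scale[OF lin])
  moreover have "bij ?\<phi>" using bij by (rule bij_imp_bij_inv)
  ultimately show ?thesis by (intro that[of ?\<phi>]) (simp_all add: lie_automorphism_def)
qed

section \<open>Changing the complement of \<open>heis\<close>\<close>

text \<open>The curve \<open>(t, c t)\<close> is the one-parameter subgroup of \<open>G\<^sub>\<rho>\<close> with tangent vector \<open>(1, w)\<close>. As \<open>Heis\<close> is
  two-step nilpotent, its differential equation is solved by two integrations: \<open>d\<close> solves it modulo
  the centre, and \<open>e\<close> corrects the central component.\<close>

lemma (in lie_flow) one_parameter_subgroup_exists:
  obtains c where "smooth_on UNIV c" "c 0 = 0" "\<And>s t. c (s + t) = c s \<odot> \<rho> s (c t)"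
    "(c has_vector_derivative w) (at 0)"
proof -
  note [simp] = bracket_add_left bracket_add_right bracket_scaleR_left bracket_scaleR_right
  have cont: "continuous_on UNIV (\<lambda>t. \<rho> t w)" by (rule smooth_on_continuous_on[OF smooth_curve])
  obtain d where d: "\<And>t. (d has_vector_derivative \<rho> t w) (at t)" and d0: "d 0 = 0"
    using antiderivative_vanishing_at_0[OF cont] by blast
  have sd: "smooth_on UNIV d" by (rule smooth_on_vector_derivative[OF open_UNIV d smooth_curve])
  have dadd: "d (s + t) = d s + \<rho> s (d t)" for s t
  proof (rule vector_derivative_eq_imp_eq[where f = "\<lambda>t. d (s + t)" and h = "\<lambda>t. \<rho> (s + t) w"])
    show "((\<lambda>t. d (s + t)) has_vector_derivative \<rho> (s + t) w) (at t)" for t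
      using has_vector_derivative_shift[OF d] .
    show "((\<lambda>t. d s + \<rho> s (d t)) has_vector_derivative \<rho> (s + t) w) (at t)" for t
      using has_vector_derivative_add[OF has_vector_derivative_const bounded_linear.has_vector_derivative[OF bounded_linear d]]
      by (simp add: add)
  qed (simp add: d0 lin_simps)
  define h where "h t = (1/2) * bracket (d t) (\<rho> t w) $ 1" for t
  have sh: "smooth_on UNIV h" unfolding h_def
    by (intro smooth_on_mult smooth_on_const smooth_on_nth smooth_on_bracket sd smooth_curve open_UNIV)
  obtain e where e: "\<And>t. (e has_vector_derivative h t) (at t)" and e0: "e 0 = 0"
    using antiderivative_vanishing_at_0[OF smooth_on_continuous_on[OF sh]] by blast
  have se: "smooth_on UNIV e" by (rule smooth_on_vector_derivative[OF open_UNIV e sh])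
  define c where "c t = d t + e t *\<^sub>R heis_Z" for t
  have bc: "bracket (c t) v = bracket (d t) v" for t v by (simp add: c_def)
  have bc2: "bracket (\<rho> s (c t)) v = bracket (\<rho> s (d t)) v" for s t v
    by (simp add: c_def lin_simps flow_Z)
  define F where "F t = \<rho> t w + (1/2) *\<^sub>R bracket (d t) (\<rho> t w)" for t
  have c': "(c has_vector_derivative F t) (at t)" for t
  proof -
    have "(c has_vector_derivative (\<rho> t w + h t *\<^sub>R heis_Z)) (at t)"
      unfolding c_def
      by (intro has_vector_derivative_add d bounded_linear.has_vector_derivative[OF bounded_linear_scaleR_left e])
    moreover have "\<rho> t w + h t *\<^sub>R heis_Z = F t"
      by (rule heis_eqI) (simp_all add: F_def h_def)
    ultimately show ?thesis by simp
  qed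
  have "c (s + t) = c s \<odot> \<rho> s (c t)" for s t
  proof (rule vector_derivative_eq_imp_eq[where f = "\<lambda>t. c (s + t)" and h = "\<lambda>t. F (s + t)"])
    show "((\<lambda>t. c (s + t)) has_vector_derivative F (s + t)) (at t)" for t
      using has_vector_derivative_shift[OF c'] .
    show "((\<lambda>t. c s \<odot> \<rho> s (c t)) has_vector_derivative F (s + t)) (at t)" for t
    proof -
      have r: "((\<lambda>t. \<rho> s (c t)) has_vector_derivative \<rho> s (F t)) (at t)"
        by (rule bounded_linear.has_vector_derivative[OF bounded_linear c'])
      have "((\<lambda>t. c s + \<rho> s (c t) + (1/2) *\<^sub>R bracket (c s) (\<rho> s (c t))) has_vector_derivative
          0 + \<rho> s (F t) + (1/2) *\<^sub>R bracket (c s) (\<rho> s (F t))) (at t)"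
        by (intro has_vector_derivative_add has_vector_derivative_const r
            bounded_linear.has_vector_derivative[OF bounded_linear_scaleR_right]
            bounded_linear.has_vector_derivative[OF bounded_bilinear.bounded_linear_right[OF bounded_bilinear_bracket]])
      moreover have "0 + \<rho> s (F t) + (1/2) *\<^sub>R bracket (c s) (\<rho> s (F t)) = F (s + t)"
        by (simp add: F_def lin_simps bracket bc dadd add scaleR_add_right)
      ultimately show ?thesis by (simp add: heis_mult_def)
    qed
  qed (simp add: c_def d0 e0 lin_simps)
  moreover have "smooth_on UNIV c" unfolding c_def
    by (intro smooth_on_add sd smooth_on_scaleR se smooth_on_const open_UNIV)
  moreover have "c 0 = 0" by (simp add: c_def d0 e0)
  moreover have "(c has_vector_derivative w) (at 0)" using c'[of 0] by (simp add: F_def d0)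
  ultimately show ?thesis using that by blast
qed

text \<open>The adjoint action of the one-parameter subgroup \<open>(t, c t)\<close> on \<open>heis\<close>: first \<open>\<rho> t\<close>, then conjugation by
  \<open>c t\<close>. This is why adding \<open>ad w\<close> to the generator does not change the group \<open>G\<^sub>\<rho>\<close>.\<close>

lemma (in lie_flow) lie_flow_twist:
  assumes c: "c 0 = 0" "\<And>s t. c (s + t) = c s \<odot> \<rho> s (c t)" "(c has_vector_derivative w) (at 0)"
  shows "lie_flow (\<lambda>t v. \<rho> t v + bracket (c t) (\<rho> t v)) (\<lambda>v. A v + bracket w v)"
proof (rule lie_flow.intro)
  note [simp] = bracket_add_left bracket_add_right bracket_scaleR_left bracket_scaleR_right
  show "linear (\<lambda>v. \<rho> t v + bracket (c t) (\<rho> t v))" for t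
    by (rule linearI) (simp_all add: lin_simps algebra_simps)
  show "\<rho> t (bracket v w) + bracket (c t) (\<rho> t (bracket v w)) =
       bracket (\<rho> t v + bracket (c t) (\<rho> t v)) (\<rho> t w + bracket (c t) (\<rho> t w))" for t v w
    by (simp add: bracket)
  show "\<rho> (s + t) v + bracket (c (s + t)) (\<rho> (s + t) v) =
       \<rho> s (\<rho> t v + bracket (c t) (\<rho> t v)) + bracket (c s) (\<rho> s (\<rho> t v + bracket (c t) (\<rho> t v)))" for s t v
    by (simp add: c(2) add heis_mult_def lin_simps bracket)
  show "\<rho> 0 v + bracket (c 0) (\<rho> 0 v) = v" for v by (simp add: c(1))
  show "((\<lambda>t. \<rho> t v + bracket (c t) (\<rho> t v)) has_vector_derivative A v + bracket w v) (at 0)" for v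
    using has_vector_derivative_add[OF deriv_0 bounded_bilinear.has_vector_derivative[OF bounded_bilinear_bracket c(3) deriv_0]]
    by (simp add: c(1))
qed

lemma (in lie_flow) lie_flow_rescale: "lie_flow (\<lambda>t. \<rho> (\<alpha> * t)) (\<lambda>v. \<alpha> *\<^sub>R A v)"
proof (rule lie_flow.intro)
  show "((\<lambda>t. \<rho> (\<alpha> * t) v) has_vector_derivative \<alpha> *\<^sub>R A v) (at 0)" for v
  proof -
    have "((\<lambda>t. \<alpha> * t) has_vector_derivative \<alpha>) (at 0)" by (auto intro!: derivative_eq_intros)
    from vector_diff_chain_at[OF this, of "\<lambda>t. \<rho> t v" "A v"] deriv_0 show ?thesis by (simp add: o_def)
  qed
qed (simp_all add: linear bracket distrib_left add)

lemma (in lie_flow) lie_flow_conjugate: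
  assumes \<phi>: "lie_automorphism \<phi>" "lie_automorphism \<psi>" "\<And>v. \<phi> (\<psi> v) = v" "\<And>v. \<psi> (\<phi> v) = v"
  shows "lie_flow (\<lambda>t v. \<phi> (\<rho> t (\<psi> v))) (\<lambda>v. \<phi> (A (\<psi> v)))"
proof (rule lie_flow.intro)
  have l: "linear \<phi>" "linear \<psi>" and b: "\<phi> (bracket v w) = bracket (\<phi> v) (\<phi> w)"
    "\<psi> (bracket v w) = bracket (\<psi> v) (\<psi> w)" for v w
    using assms by (auto simp: lie_automorphism_def)
  show "linear (\<lambda>v. \<phi> (\<rho> t (\<psi> v)))" for t
    using linear_compose[OF linear_compose[OF l(2) linear] l(1)] by (simp add: o_def)
  show "((\<lambda>t. \<phi> (\<rho> t (\<psi> v))) has_vector_derivative \<phi> (A (\<psi> v))) (at 0)" for v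
    using bounded_linear.has_vector_derivative[OF _ deriv_0] l(1) linear_conv_bounded_linear by blast
  show "\<phi> (\<rho> t (\<psi> (bracket v w))) = bracket (\<phi> (\<rho> t (\<psi> v))) (\<phi> (\<rho> t (\<psi> w)))" for t v w
    by (simp only: b bracket)
qed (simp_all add: assms(3,4) add)

section \<open>Isomorphisms and the model groups\<close>

text \<open>An isomorphism together with its inverse, for groups whose carrier is the whole type. Naming the
  inverse avoids \<open>inv_into\<close> when isomorphisms are composed.\<close>

definition smooth_iso_pair where
  "smooth_iso_pair H K f g \<longleftrightarrow> (\<forall>x y. f (x \<otimes>\<^bsub>H\<^esub> y) = f x \<otimes>\<^bsub>K\<^esub> f y) \<and>
     (\<forall>x. g (f x) = x) \<and> (\<forall>y. f (g y) = y) \<and> smooth_on UNIV f \<and> smooth_on UNIV g"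

lemma smooth_iso_pair_imp_lie_isomorphic:
  assumes "carrier H = UNIV" "carrier K = UNIV" "smooth_iso_pair H K f g"
  shows "lie_isomorphic H K"
proof -
  have "bij f" using assms(3) by (intro o_bij[of g]) (auto simp: smooth_iso_pair_def fun_eq_iff)
  moreover have "inv_into UNIV f = g" using assms(3) by (intro inv_equality) (auto simp: smooth_iso_pair_def)
  ultimately show ?thesis using assms unfolding lie_isomorphic_def
    by (intro exI[of _ f]) (auto simp: smooth_iso_pair_def iso_def hom_def)
qed

lemma lie_isomorphic_imp_smooth_iso_pair:
  assumes "carrier H = UNIV" "carrier K = UNIV" "lie_isomorphic H K"
  obtains f g where "smooth_iso_pair H K f g"
proof -
  obtain F where F: "F \<in> iso H K" "smooth_on UNIV F" "smooth_on UNIV (inv_into UNIV F)"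
    using assms(3) by (auto simp: lie_isomorphic_def)
  then have "bij F" using assms by (simp add: iso_def)
  then have "smooth_iso_pair H K F (inv_into UNIV F)"
    using F assms by (auto simp: smooth_iso_pair_def iso_def hom_def bij_is_inj bij_is_surj surj_f_inv_f)
  then show ?thesis using that by blast
qed

lemma smooth_iso_pair_sym:
  assumes "smooth_iso_pair H K f g"
  shows "smooth_iso_pair K H g f"
proof -
  have "g (x \<otimes>\<^bsub>K\<^esub> y) = g x \<otimes>\<^bsub>H\<^esub> g y" for x y
  proof -
    have "f (g x \<otimes>\<^bsub>H\<^esub> g y) = x \<otimes>\<^bsub>K\<^esub> y" using assms by (simp add: smooth_iso_pair_def)
    moreover have "g (f z) = z" for z using assms by (simp add: smooth_iso_pair_def)
    ultimately show ?thesis by metis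
  qed
  then show ?thesis using assms by (simp add: smooth_iso_pair_def)
qed

lemma smooth_iso_pair_trans:
  fixes f :: "'a::euclidean_space \<Rightarrow> 'b::euclidean_space" and f' :: "'b \<Rightarrow> 'c::euclidean_space"
  assumes "smooth_iso_pair H K f g" "smooth_iso_pair K L f' g'"
  shows "smooth_iso_pair H L (\<lambda>x. f' (f x)) (\<lambda>y. g (g' y))"
proof -
  have "smooth_on UNIV (\<lambda>x. f' (f x))"
    by (rule smooth_on_compose[OF open_UNIV open_UNIV]) (use assms in \<open>simp_all add: smooth_iso_pair_def\<close>)
  moreover have "smooth_on UNIV (\<lambda>y. g (g' y))"
    by (rule smooth_on_compose[OF open_UNIV open_UNIV]) (use assms in \<open>simp_all add: smooth_iso_pair_def\<close>)
  ultimately show ?thesis using assms by (simp add: smooth_iso_pair_def)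
qed

text \<open>The generator, rescaled by \<open>\<alpha>\<close> and corrected by \<open>ad w\<close>, is conjugate to the normal form under \<open>\<psi>\<close>.
  Since conjugation by \<open>(\<alpha> * t, c t)\<close> integrates it, sending \<open>(t, 0)\<close> to that element and \<open>heis\<close> to
  itself by \<open>\<psi>\<close> is compatible with the semidirect products.\<close>

lemma (in lie_flow) model_isomorphism:
  assumes "rate \<noteq> 0" "admissible \<rho> W"
  obtains b \<tau> \<Psi> \<Psi>' where "lie_flow \<tau> ((*v) (normal_form b))" "has_normal_form \<rho> b"
    "smooth_iso_pair (G_rho \<tau>) (G_rho \<rho>) \<Psi> \<Psi>'" "\<And>s. \<Psi> (0, s *\<^sub>R heis_Y) = (0, s *\<^sub>R W)"
proof -
  note [simp] = bracket_add_left bracket_add_right bracket_scaleR_left bracket_scaleR_right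
  define \<alpha> where "\<alpha> = 1 / rate"
  have \<alpha>: "\<alpha> * rate = 1" "rate * \<alpha> = 1" "\<alpha> \<noteq> 0" using assms(1) by (simp_all add: \<alpha>_def)
  obtain b w \<psi> where \<psi>: "lie_automorphism \<psi>" "\<psi> heis_Y = W"
    and eq: "\<And>v. \<psi> (normal_form b *v v) = \<alpha> *\<^sub>R A (\<psi> v) + bracket w (\<psi> v)"
    using normal_form_basis[OF assms(1) admissible_cyclic[OF assms(2)]] unfolding \<alpha>_def by blast
  obtain \<phi> where \<phi>: "lie_automorphism \<phi>" "\<And>v. \<phi> (\<psi> v) = v" "\<And>v. \<psi> (\<phi> v) = v"
    using lie_automorphism_inverse[OF \<psi>(1)] by blast
  have "\<phi> (\<alpha> *\<^sub>R A v + bracket w v) = normal_form b *v \<phi> v" for v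
    using arg_cong[OF eq[of "\<phi> v"], of \<phi>] by (simp add: \<phi>(2,3))
  then have nf: "has_normal_form \<rho> b"
    unfolding has_normal_form_def using derivation_A generates \<alpha>(3) \<phi>(1) by blast
  let ?R = "\<lambda>t. \<rho> (\<alpha> * t)"
  interpret R: lie_flow ?R "\<lambda>v. \<alpha> *\<^sub>R A v" by (rule lie_flow_rescale)
  obtain c where c: "smooth_on UNIV c" "c 0 = 0" "\<And>s t. c (s + t) = c s \<odot> ?R s (c t)"
    "(c has_vector_derivative w) (at 0)"
    using R.one_parameter_subgroup_exists[of w] by blast
  let ?S = "\<lambda>t v. ?R t v + bracket (c t) (?R t v)"
  interpret S: lie_flow ?S "\<lambda>v. \<alpha> *\<^sub>R A v + bracket w v" by (rule R.lie_flow_twist[OF c(2-4)])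
  let ?\<tau> = "\<lambda>t v. \<phi> (?S t (\<psi> v))"
  have "lie_flow ?\<tau> (\<lambda>v. \<phi> (\<alpha> *\<^sub>R A (\<psi> v) + bracket w (\<psi> v)))"
    by (rule S.lie_flow_conjugate[OF \<phi>(1) \<psi>(1) \<phi>(2,3)])
  then have \<tau>: "lie_flow ?\<tau> ((*v) (normal_form b))"
    by (simp add: eq[symmetric] \<phi>)
  have lin: "linear \<psi>" "linear \<phi>" and \<psi>br: "\<psi> (bracket u v) = bracket (\<psi> u) (\<psi> v)" for u v
    using \<psi> \<phi> by (auto simp: lie_automorphism_def)
  have \<psi>mult: "\<psi> (p \<odot> q) = \<psi> p \<odot> \<psi> q" for p q
    by (simp add: heis_mult_def linear_add[OF lin(1)] linear_scale[OF lin(1)] \<psi>br)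
  have conj: "?S s v \<odot> c s = c s \<odot> ?R s v" for s v
    by (rule heis_eqI) (simp_all add: field_simps)
  define \<Psi> where "\<Psi> x = (\<alpha> * fst x, \<psi> (snd x) \<odot> c (fst x))" for x :: "real \<times> heis"
  define \<Psi>' where "\<Psi>' x = (rate * fst x, \<phi> (snd x \<odot> - c (rate * fst x)))" for x :: "real \<times> heis"
  have "smooth_iso_pair (G_rho ?\<tau>) (G_rho \<rho>) \<Psi> \<Psi>'"
    unfolding smooth_iso_pair_def
  proof (intro conjI allI)
    fix x y :: "real \<times> heis"
    obtain s p t q where [simp]: "x = (s, p)" "y = (t, q)" by (cases x, cases y)
    have "\<psi> p \<odot> ?S s (\<psi> q) \<odot> c (s + t) = \<psi> p \<odot> (?S s (\<psi> q) \<odot> c s) \<odot> ?R s (c t)"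
      by (simp only: c(3) heis_mult_assoc)
    also have "\<dots> = \<psi> p \<odot> c s \<odot> ?R s (\<psi> q \<odot> c t)"
      by (simp only: conj heis_mult_assoc R.mult)
    finally show "\<Psi> (x \<otimes>\<^bsub>G_rho ?\<tau>\<^esub> y) = \<Psi> x \<otimes>\<^bsub>G_rho \<rho>\<^esub> \<Psi> y"
      by (simp add: \<Psi>_def \<psi>mult \<phi>(3) distrib_left)
  next
    show "\<Psi>' (\<Psi> x) = x" for x
      by (cases x) (simp add: \<Psi>_def \<Psi>'_def heis_mult_assoc \<phi> \<alpha> flip: mult.assoc)
    show "\<Psi> (\<Psi>' x) = x" for x
      by (cases x) (simp add: \<Psi>_def \<Psi>'_def heis_mult_assoc \<phi> \<alpha> flip: mult.assoc)
    have bl: "bounded_linear \<psi>" "bounded_linear \<phi>" using lin by (simp_all add: linear_conv_bounded_linear)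
    have c': "smooth_on UNIV (\<lambda>x. c (f x))" if "smooth_on UNIV f" for f :: "real \<times> heis \<Rightarrow> real"
      using smooth_on_compose[OF open_UNIV open_UNIV c(1) that] by simp
    have fs: "smooth_on UNIV (\<lambda>x::real \<times> heis. fst x)" "smooth_on UNIV (\<lambda>x::real \<times> heis. snd x)"
      by (intro smooth_on_bounded_linear bounded_linear_fst bounded_linear_snd)+
    show "smooth_on UNIV \<Psi>" unfolding \<Psi>_def
      by (intro smooth_on_Pair smooth_on_mult smooth_on_const fs smooth_on_heis_mult open_UNIV c'
          smooth_on_linear_compose[OF _ bl(1)])
    show "smooth_on UNIV \<Psi>'" unfolding \<Psi>'_def
      by (intro smooth_on_Pair smooth_on_mult smooth_on_const fs smooth_on_heis_mult open_UNIV smooth_on_minus c'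
          smooth_on_linear_compose[OF _ bl(2)])
  qed
  moreover have "\<Psi> (0, s *\<^sub>R heis_Y) = (0, s *\<^sub>R W)" for s
    by (simp add: \<Psi>_def c(2) linear_scale[OF lin(1)] \<psi>(2))
  ultimately show ?thesis using that \<tau> nf by blast
qed

section \<open>The invariant separates the groups\<close>

lemma model_flow_Z:
  assumes "lie_flow \<tau> ((*v) (normal_form b))"
  shows "\<tau> t heis_Z = exp t *\<^sub>R heis_Z"
proof -
  interpret lie_flow \<tau> "(*v) (normal_form b)" by fact
  show ?thesis using flow_Z[of t] by (simp add: rate_def)
qed

text \<open>The hypothesis says that \<open>D\<close> is the commutator of \<open>(k, p)\<close> with a central element of \<open>Heis\<close>; this form
  is preserved by homomorphisms and needs no inverses.\<close>

lemma model_commutator: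
  assumes "lie_flow \<tau> ((*v) (normal_form b))"
    and eq: "(k, p) \<otimes>\<^bsub>G_rho \<tau>\<^esub> (0, z *\<^sub>R heis_Z) = D \<otimes>\<^bsub>G_rho \<tau>\<^esub> ((0, z *\<^sub>R heis_Z) \<otimes>\<^bsub>G_rho \<tau>\<^esub> (k, p))"
  shows "D = (0, ((exp k - 1) * z) *\<^sub>R heis_Z)"
proof -
  interpret lie_flow \<tau> "(*v) (normal_form b)" by fact
  obtain a x where D: "D = (a, x)" by (cases D)
  have "a = 0" using eq by (simp add: D)
  then show ?thesis using eq
    by (auto simp: D heis_eq_iff lin_simps model_flow_Z[OF assms(1)] algebra_simps)
qed

text \<open>An element of \<open>Heis\<close> acts unipotently on the whole group by conjugation: its third iterated commutator
  with any element is trivial. Conjugation by \<open>(k, p)\<close> multiplies the centre of \<open>Heis\<close> by \<open>exp k\<close>. If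
  \<open>H (0, p) = (k, p')\<close>, the iterated commutators with the preimage of \<open>Z\<close> therefore give
  \<open>(exp k - 1) ^ 3 = 0\<close>.\<close>

lemma model_iso_preserves_heis:
  assumes T: "lie_flow \<tau> ((*v) (normal_form b))" and T': "lie_flow \<tau>' ((*v) (normal_form b'))"
    and H: "smooth_iso_pair (G_rho \<tau>) (G_rho \<tau>') H H'"
  shows "fst (H (0, p)) = 0"
proof -
  interpret lie_flow \<tau> "(*v) (normal_form b)" by (rule T)
  have hom: "H (x \<otimes>\<^bsub>G_rho \<tau>\<^esub> y) = H x \<otimes>\<^bsub>G_rho \<tau>'\<^esub> H y" for x y
    using H unfolding smooth_iso_pair_def by blast
  obtain k p' where k: "H (0, p) = (k, p')" by fastforce
  obtain t v where q: "H' (0, heis_Z) = (t, v)" by fastforce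
  have "H (H' y) = y" for y using H unfolding smooth_iso_pair_def by blast
  from this[of "(0, heis_Z)"] have Hq: "H (t, v) = (0, 1 *\<^sub>R heis_Z)" by (simp add: q)
  define h where "h = (p \<odot> v) \<odot> - (v \<odot> \<tau> t p)"
  have "(0, p) \<otimes>\<^bsub>G_rho \<tau>\<^esub> (t, v) = (0, h) \<otimes>\<^bsub>G_rho \<tau>\<^esub> ((t, v) \<otimes>\<^bsub>G_rho \<tau>\<^esub> (0, p))"
    by (simp add: h_def heis_mult_assoc)
  from arg_cong[OF this, of H] have "H (0, h) = (0, ((exp k - 1) * 1) *\<^sub>R heis_Z)"
    unfolding hom k Hq by (rule model_commutator[OF T'])
  then have 1: "H (0, h) = (0, (exp k - 1) *\<^sub>R heis_Z)" by simp
  have "(0, p) \<otimes>\<^bsub>G_rho \<tau>\<^esub> (0, h) = (0, bracket p h) \<otimes>\<^bsub>G_rho \<tau>\<^esub> ((0, h) \<otimes>\<^bsub>G_rho \<tau>\<^esub> (0, p))"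
    by (simp add: heis_eq_iff field_simps)
  from arg_cong[OF this, of H] have 2: "H (0, bracket p h) = (0, ((exp k - 1) * (exp k - 1)) *\<^sub>R heis_Z)"
    unfolding hom k 1 by (rule model_commutator[OF T'])
  have "(0, p) \<otimes>\<^bsub>G_rho \<tau>\<^esub> (0, bracket p h) = (0, 0) \<otimes>\<^bsub>G_rho \<tau>\<^esub> ((0, bracket p h) \<otimes>\<^bsub>G_rho \<tau>\<^esub> (0, p))"
    by (simp add: heis_eq_iff)
  from arg_cong[OF this, of H] have 3: "H (0, 0) = (0, ((exp k - 1) * ((exp k - 1) * (exp k - 1))) *\<^sub>R heis_Z)"
    unfolding hom k 2 by (rule model_commutator[OF T'])
  interpret T': lie_flow \<tau>' "(*v) (normal_form b')" by (rule T')
  have "H (0, 0) = H (0, 0) \<otimes>\<^bsub>G_rho \<tau>'\<^esub> H (0, 0)"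
    using hom[of "(0, 0)" "(0, 0)"] by simp
  then have "exp k - 1 = 0" unfolding 3 by (simp add: heis_eq_iff)
  then show ?thesis by (simp add: k)
qed

text \<open>The isomorphism maps \<open>Heis\<close> to \<open>Heis\<close>, where it is linear because it is continuous. Conjugation by
  \<open>(t, 0)\<close> scales the centre by \<open>exp t\<close> on both sides, so \<open>t\<close> is preserved, and modulo the centre the
  isomorphism intertwines the two flows and hence their generators. These are similar 2 by 2 matrices
  with determinants \<open>-b\<close> and \<open>-b'\<close>.\<close>

theorem model_iso_imp_eq:
  assumes T: "lie_flow \<tau> ((*v) (normal_form b))" and T': "lie_flow \<tau>' ((*v) (normal_form b'))"
    and H: "smooth_iso_pair (G_rho \<tau>) (G_rho \<tau>') H H'"
  shows "b = b'"
proof -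
  interpret T: lie_flow \<tau> "(*v) (normal_form b)" by (rule T)
  interpret T': lie_flow \<tau>' "(*v) (normal_form b')" by (rule T')
  have hom: "H (x \<otimes>\<^bsub>G_rho \<tau>\<^esub> y) = H x \<otimes>\<^bsub>G_rho \<tau>'\<^esub> H y" for x y
    using H unfolding smooth_iso_pair_def by blast
  have inv: "H' (H x) = x" "H (H' y) = y" for x y using H unfolding smooth_iso_pair_def by blast+
  define \<phi> where "\<phi> p = snd (H (0, p))" for p
  have \<phi>: "H (0, p) = (0, \<phi> p)" for p
    using model_iso_preserves_heis[OF T T' H, of p] by (simp add: \<phi>_def prod_eq_iff)
  define \<phi>' where "\<phi>' p = snd (H' (0, p))" for p
  have \<phi>': "H' (0, p) = (0, \<phi>' p)" for p
    using model_iso_preserves_heis[OF T' T smooth_iso_pair_sym[OF H], of p] by (simp add: \<phi>'_def prod_eq_iff)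
  have "\<phi>' (\<phi> p) = p" "\<phi> (\<phi>' p) = p" for p
    using inv(1)[of "(0, p)"] inv(2)[of "(0, p)"] by (simp_all add: \<phi> \<phi>')
  then have "bij \<phi>" by (intro o_bij[of \<phi>']) (simp_all add: fun_eq_iff)
  have "\<phi> (p \<odot> q) = \<phi> p \<odot> \<phi> q" for p q
    using hom[of "(0, p)" "(0, q)"] by (simp add: \<phi>)
  moreover have "continuous_on UNIV \<phi>"
  proof -
    have "continuous_on UNIV H" using H by (simp add: smooth_iso_pair_def smooth_on_continuous_on)
    then have "continuous_on UNIV (\<lambda>p. H (0, p))"
      by (rule continuous_on_compose2) (auto intro!: continuous_on_Pair continuous_on_const continuous_on_id)
    then show ?thesis unfolding \<phi>_def by (rule continuous_on_snd)
  qed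
  ultimately have lin: "linear \<phi>" and br: "\<phi> (bracket v w) = bracket (\<phi> v) (\<phi> w)" for v w
    by (rule continuous_hom_linear)+
  have aut: "lie_automorphism \<phi>" using lin br \<open>bij \<phi>\<close> by (simp add: lie_automorphism_def)
  note Z = lie_automorphism_Z[OF aut]
  have equivariant: "\<tau>' t (\<phi> p) $ i = \<phi> (\<tau> t p) $ i" if i: "i = 2 \<or> i = 3" for t p i
  proof -
    obtain \<kappa> c where \<kappa>: "H (t, 0) = (\<kappa>, c)" by fastforce
    have conj: "c \<odot> \<tau>' \<kappa> (\<phi> p) = \<phi> (\<tau> t p) \<odot> c" for p
    proof -
      have "(t, 0) \<otimes>\<^bsub>G_rho \<tau>\<^esub> (0, p) = (0, \<tau> t p) \<otimes>\<^bsub>G_rho \<tau>\<^esub> (t, 0)" by (simp add: T.lin_simps)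
      from arg_cong[OF this, of H] show ?thesis unfolding hom by (simp add: \<phi> \<kappa>)
    qed
    have "exp \<kappa> = exp t"
      using conj[of heis_Z] Z(2)
      by (simp add: Z(1) model_flow_Z[OF T] model_flow_Z[OF T'] T'.lin_simps linear_scale[OF lin] heis_eq_iff)
    then have "\<kappa> = t" by simp
    then show ?thesis using conj[of p] i by (auto simp: heis_eq_iff)
  qed
  have gen: "(normal_form b' *v \<phi> p) $ i = \<phi> (normal_form b *v p) $ i" if i: "i = 2 \<or> i = 3" for p i
  proof -
    have "((\<lambda>t. \<tau>' t (\<phi> p) $ i) has_real_derivative (normal_form b' *v \<phi> p) $ i) (at 0)"
      using T'.deriv_nth[of "\<phi> p" i 0] by simp
    moreover have "((\<lambda>t. \<phi> (\<tau> t p) $ i) has_real_derivative \<phi> (normal_form b *v p) $ i) (at 0)"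
      using bounded_linear.has_vector_derivative[OF bounded_linear_compose[OF bounded_linear_vec_nth lin[unfolded linear_conv_bounded_linear]] T.deriv_0]
      by (simp add: has_real_derivative_iff_has_vector_derivative)
    ultimately show ?thesis unfolding equivariant[OF i] by (rule DERIV_unique)
  qed
  define p q r s where pqrs: "p = \<phi> heis_X $ 2" "q = \<phi> heis_Y $ 2" "r = \<phi> heis_X $ 3" "s = \<phi> heis_Y $ 3"
  have comp: "\<phi> v $ 2 = v$2 * p + v$3 * q" "\<phi> v $ 3 = v$2 * r + v$3 * s" for v
    by (subst linear_heis_expansion[OF lin], simp add: Z(1) pqrs)+
  have "r = b * q" "b' * p + r = b * s" "s = p + q" "b' * q + s = r + s"
    using gen[of 2 heis_X] gen[of 3 heis_X] gen[of 2 heis_Y] gen[of 3 heis_Y]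
    by (simp_all add: comp)
  moreover have "p * s - r * q \<noteq> 0" using Z(2) by (simp add: pqrs)
  ultimately show ?thesis
    by (cases "q = 0") (auto simp: algebra_simps)
qed

section \<open>Plane wave coordinates on the model\<close>

abbreviation (input) half_space :: "(real^3) set" where "half_space \<equiv> {y. 0 < y$1}"

abbreviation (input) base :: "real^3" where "base \<equiv> vector [1, 0, 0]"

lemma open_half_space: "open half_space"
  by (intro open_Collect_less continuous_intros)

lemma vector3_eq_iff: "v = w \<longleftrightarrow> v$1 = w$1 \<and> v$2 = w$2 \<and> v$3 = w$3" for v w :: "real^3"
  by (rule heis_eq_iff)

lemma has_derivative_vector3:
  fixes f g h :: "'a::real_normed_vector \<Rightarrow> real"
  assumes "(f has_derivative f') F" "(g has_derivative g') F" "(h has_derivative h') F"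
  shows "((\<lambda>x. vector [f x, g x, h x] :: real^3) has_derivative (\<lambda>v. vector [f' v, g' v, h' v])) F"
proof -
  have *: "(vector [p, q, r] :: real^3) = p *\<^sub>R axis 1 1 + q *\<^sub>R axis 2 1 + r *\<^sub>R axis 3 1" for p q r :: real
    by (simp add: vector3_eq_iff axis_def)
  show ?thesis unfolding *
    by (intro has_derivative_add has_derivative_scaleR_left assms)
qed

text \<open>A map with a differentiable section through a point is a submersion there.\<close>

lemma surj_frechet_derivative_of_right_inverse:
  assumes "open S" "y \<in> S" "f differentiable at (g y)" "g differentiable at y"
    "\<And>z. z \<in> S \<Longrightarrow> f (g z) = z"
  shows "surj (frechet_derivative f (at (g y)))"
proof -
  note f = assms(3)[unfolded frechet_derivative_works]
  note g = assms(4)[unfolded frechet_derivative_works]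
  have "((\<lambda>y. f (g y)) has_derivative (\<lambda>v. frechet_derivative f (at (g y)) (frechet_derivative g (at y) v))) (at y)"
    by (rule has_derivative_compose[OF g f])
  moreover have "((\<lambda>y. f (g y)) has_derivative (\<lambda>v. v)) (at y)"
    by (rule has_derivative_transform_within_open[OF has_derivative_ident assms(1,2)]) (simp add: assms(5))
  ultimately have "(\<lambda>v. frechet_derivative f (at (g y)) (frechet_derivative g (at y) v)) = (\<lambda>v. v)"
    by (rule has_derivative_unique)
  then show ?thesis by (metis surjI)
qed

text \<open>In \<open>\<eta> = \<tau> (- t) p\<close>, right multiplication of \<open>(t, p)\<close> by \<open>(0, s *\<^sub>R heis_Y)\<close> becomes right multiplication
  of \<open>\<eta>\<close> by \<open>s *\<^sub>R heis_Y\<close>, whose invariants are \<open>\<eta>$2\<close> and \<open>\<eta>$1 - \<eta>$2 * \<eta>$3 / 2\<close>. The weights \<open>exp (- t)\<close>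
  and \<open>exp t\<close> below are such that the element \<open>(t, 0)\<close> acts on \<open>(u, v, x)\<close> by
  \<open>(exp (- t) * u, exp t * v, x)\<close>, an isometry of the plane wave.\<close>

locale model_flow = lie_flow \<tau> "(*v) (normal_form b)" for \<tau> b
begin

definition coord :: "real \<times> heis \<Rightarrow> real^3" where
  "coord g = (let \<eta> = \<tau> (- fst g) (snd g)
     in vector [exp (- fst g), exp (fst g) * (\<eta>$1 - \<eta>$2 * \<eta>$3 / 2), \<eta>$2])"

text \<open>The point of the fibre over \<open>y\<close> at which \<open>\<eta>$3\<close> is \<open>s\<close>.\<close>

definition section_through :: "real \<Rightarrow> real^3 \<Rightarrow> real \<times> heis" where
  "section_through s y = (- ln (y$1), \<tau> (- ln (y$1)) (vector [y$1 * y$2, y$3, 0] \<odot> s *\<^sub>R heis_Y))"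

text \<open>Left translation in the coordinates. An element \<open>(0, p)\<close> of \<open>Heis\<close> shifts \<open>x\<close> by the function
  \<open>f u = \<tau> (ln u) p $ 2\<close>, a solution of \<open>f'' = b * f / u\<^sup>2\<close> with \<open>f' u = \<tau> (ln u) p $ 3 / u\<close>; these are the
  Heisenberg symmetries of the plane wave.\<close>

definition action :: "real \<times> heis \<Rightarrow> real^3 \<Rightarrow> real^3" where
  "action a y = (let U = exp (- fst a) * y$1; \<pi> = \<tau> (ln U) (snd a)
     in vector [U, exp (fst a) * y$2 + (\<pi>$1 - \<pi>$2 * \<pi>$3 / 2 - \<pi>$3 * y$3) / U, y$3 + \<pi>$2])"

lemma coord_simp: "coord (t, \<tau> t \<eta>) = vector [exp (- t), exp t * (\<eta>$1 - \<eta>$2 * \<eta>$3 / 2), \<eta>$2]"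
  by (simp add: coord_def Let_def)

lemma coord_cases:
  obtains t \<eta> where "g = (t, \<tau> t \<eta>)"
  by (metis inverse(2) surj_pair)

lemma smooth_coord: "smooth_on UNIV coord"
proof -
  have fs: "smooth_on UNIV (\<lambda>x::real \<times> heis. fst x)" "smooth_on UNIV (\<lambda>x::real \<times> heis. snd x)"
    by (intro smooth_on_bounded_linear bounded_linear_fst bounded_linear_snd)+
  have e: "smooth_on UNIV (\<lambda>x. exp (f x))" if "smooth_on UNIV f" for f :: "real \<times> heis \<Rightarrow> real"
    using smooth_on_compose[OF open_UNIV open_UNIV smooth_on_exp that] by simp
  show ?thesis unfolding coord_def Let_def divide_inverse
    by (intro smooth_on_vector3 smooth_on_mult smooth_on_diff smooth_on_nth smooth_on_flow smooth_on_minus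
        smooth_on_const e fs open_UNIV)
qed

lemma range_coord: "coord g \<in> half_space"
  by (simp add: coord_def Let_def)

lemma coord_fibre: "coord g = coord h \<longleftrightarrow> (\<exists>s. h = g \<otimes>\<^bsub>G_rho \<tau>\<^esub> (0, s *\<^sub>R heis_Y))"
proof -
  obtain t \<eta> t' \<eta>' where g: "g = (t, \<tau> t \<eta>)" "h = (t', \<tau> t' \<eta>')" by (metis coord_cases)
  have inj: "\<tau> t v = \<tau> t w \<longleftrightarrow> v = w" for t v w by (metis inverse(1))
  show ?thesis
  proof
    assume eq: "coord g = coord h"
    then have "t' = t" by (simp add: g coord_simp vector3_eq_iff)
    moreover have "\<eta>' = \<eta> \<odot> (\<eta>'$3 - \<eta>$3) *\<^sub>R heis_Y"
    proof -
      have "\<eta>'$2 = \<eta>$2" "\<eta>$1 - \<eta>$2 * \<eta>$3 / 2 = \<eta>'$1 - \<eta>'$2 * \<eta>'$3 / 2"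
        using eq \<open>t' = t\<close> by (auto simp: g coord_simp vector3_eq_iff)
      then show ?thesis by (simp add: vector3_eq_iff field_simps)
    qed
    then have "h = g \<otimes>\<^bsub>G_rho \<tau>\<^esub> (0, (\<eta>'$3 - \<eta>$3) *\<^sub>R heis_Y)"
      using \<open>t' = t\<close> by (simp add: g flip: mult)
    then show "\<exists>s. h = g \<otimes>\<^bsub>G_rho \<tau>\<^esub> (0, s *\<^sub>R heis_Y)" by blast
  next
    assume "\<exists>s. h = g \<otimes>\<^bsub>G_rho \<tau>\<^esub> (0, s *\<^sub>R heis_Y)"
    then obtain s where "t' = t" "\<eta>' = \<eta> \<odot> s *\<^sub>R heis_Y" by (auto simp: g inj simp flip: mult)
    then show "coord g = coord h"
      by (simp add: g coord_simp) (simp add: vector3_eq_iff field_simps)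
  qed
qed

lemma coord_section: "y \<in> half_space \<Longrightarrow> coord (section_through s y) = y"
  unfolding section_through_def coord_simp
  by (simp add: vector3_eq_iff exp_minus field_simps)

lemma section_through_coord: "\<exists>s. section_through s (coord g) = g"
proof -
  obtain t \<eta> where g: "g = (t, \<tau> t \<eta>)" by (rule coord_cases)
  have "vector [coord g $ 1 * coord g $ 2, coord g $ 3, 0] \<odot> \<eta>$3 *\<^sub>R heis_Y = \<eta>"
    unfolding g coord_simp by (simp add: vector3_eq_iff exp_minus mult.assoc[symmetric])
  then have "section_through (\<eta>$3) (coord g) = g"
    unfolding section_through_def by (simp add: g coord_simp)
  then show ?thesis by blast
qed

lemma smooth_section: "smooth_on half_space (section_through s)"
proof -
  have l: "smooth_on half_space (\<lambda>y. ln (y$1))"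
    by (rule smooth_on_compose[OF open_half_space open_greaterThan smooth_on_ln smooth_on_vec_nth]) auto
  show ?thesis unfolding section_through_def
    by (intro smooth_on_Pair smooth_on_flow smooth_on_minus l smooth_on_heis_mult smooth_on_vector3
        smooth_on_mult smooth_on_vec_nth smooth_on_const open_half_space)
qed

lemma coord_equivariant: "coord (a \<otimes>\<^bsub>G_rho \<tau>\<^esub> g) = action a (coord g)"
proof -
  obtain t0 p0 where a: "a = (t0, p0)" by (cases a)
  obtain t \<eta> where g: "g = (t, \<tau> t \<eta>)" by (rule coord_cases)
  \<comment> \<open>Left translation by \<open>a\<close> acts on \<open>\<eta>\<close> as left multiplication by this \<open>\<pi>\<close>.\<close>
  define \<pi> where "\<pi> = \<tau> (- (t0 + t)) p0"
  have p0: "p0 = \<tau> (t0 + t) \<pi>" unfolding \<pi>_def by (rule inverse(2)[symmetric])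
  have ag: "a \<otimes>\<^bsub>G_rho \<tau>\<^esub> g = (t0 + t, \<tau> (t0 + t) (\<pi> \<odot> \<eta>))"
    unfolding mult p0[symmetric] by (simp add: a g add)
  have U: "exp (- fst a) * coord g $ 1 = exp (- (t0 + t))"
    by (simp add: a g coord_simp exp_add[symmetric])
  have div: "x / exp (- (t0 + t)) = exp (t0 + t) * x" for x by (simp only: exp_minus divide_inverse inverse_inverse_eq mult.commute)
  have \<pi>: "\<tau> (ln (exp (- (t0 + t)))) p0 = \<pi>" by (simp only: ln_exp \<pi>_def)
  show ?thesis
    unfolding ag coord_simp action_def U Let_def unfolding a snd_conv fst_conv \<pi> div
    by (simp add: g coord_simp vector3_eq_iff) (simp add: exp_add algebra_simps add_divide_distrib diff_divide_distrib)
qed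

lemma smooth_action: "smooth_on half_space (action a)"
proof -
  have U: "smooth_on half_space (\<lambda>y. exp (- fst a) * y$1)"
    by (intro smooth_on_mult smooth_on_const smooth_on_vec_nth open_half_space)
  have l: "smooth_on half_space (\<lambda>y. ln (exp (- fst a) * y$1))"
    by (rule smooth_on_compose[OF open_half_space open_greaterThan smooth_on_ln U]) auto
  have i: "smooth_on half_space (\<lambda>y. inverse (exp (- fst a) * y$1))"
    by (rule smooth_on_compose[OF open_half_space open_greaterThan smooth_on_inverse U]) auto
  show ?thesis unfolding action_def Let_def divide_inverse
    by (intro smooth_on_vector3 smooth_on_mult smooth_on_add smooth_on_diff smooth_on_nth smooth_on_flow U l i smooth_on_vec_nth
        smooth_on_const open_half_space)
qed

text \<open>The orbit \<open>\<pi>\<close> has derivative \<open>N \<pi> / u\<close> in \<open>u\<close>, where \<open>N\<close> is the normal form. It is this \<open>N\<close> that brings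
  \<open>b\<close> into the derivative.\<close>

lemma action_has_derivative:
  assumes y: "y \<in> half_space" and \<pi>: "\<pi> = \<tau> (ln (exp (- t) * y$1)) p"
  shows "(action (t, p) has_derivative (\<lambda>\<xi>. vector [exp (- t) * \<xi>$1,
      exp t * \<xi>$2 - ((\<pi>$3)\<^sup>2 / 2 + b * \<pi>$2 * (\<pi>$2 / 2 + y$3)) / (exp (- t) * (y$1)\<^sup>2) * \<xi>$1 - \<pi>$3 / (exp (- t) * y$1) * \<xi>$3,
      \<xi>$3 + \<pi>$3 / y$1 * \<xi>$1])) (at y)"
proof -
  define c where "c = exp (- t)"
  define P where "P i u = \<tau> (ln (c * u)) p $ i" for i u
  have c: "c > 0" by (simp add: c_def)
  have P\<pi>: "P i (y$1) = \<pi> $ i" for i by (simp add: P_def \<pi> c_def)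
  have P': "(P i has_real_derivative ((normal_form b *v \<pi>) $ i) / y$1) (at (y$1))" for i
  proof -
    have "((\<lambda>u. ln (c * u)) has_real_derivative 1 / y$1) (at (y$1))"
      using y c by (auto intro!: derivative_eq_intros)
    from DERIV_chain2[OF deriv_nth this, of p i]
    show ?thesis unfolding P_def by (simp add: \<pi> c_def commute)
  qed
  note n = bounded_linear_imp_has_derivative[OF bounded_linear_vec_nth]
  have d: "((\<lambda>y. P i (y$1)) has_derivative (\<lambda>\<xi>. \<xi>$1 * (((normal_form b *v \<pi>) $ i) / y$1))) (at y)" for i
    by (rule DERIV_compose_FDERIV[OF P' n])
  have act: "action (t, p) = (\<lambda>y. vector [c * y$1, exp t * y$2 + (P 1 (y$1) - (1/2) * (P 2 (y$1) * P 3 (y$1)) - P 3 (y$1) * y$3) / (c * y$1), y$3 + P 2 (y$1)])"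
    by (simp add: fun_eq_iff action_def Let_def P_def c_def)
  have 1: "((\<lambda>y. c * y$1) has_derivative (\<lambda>\<xi>. exp (- t) * \<xi>$1)) (at y)"
    by (auto intro!: derivative_eq_intros n simp: c_def)
  have 3: "((\<lambda>y. y$3 + P 2 (y$1)) has_derivative (\<lambda>\<xi>. \<xi>$3 + \<pi>$3 / y$1 * \<xi>$1)) (at y)"
    by (rule derivative_eq_intros n d refl)+ (simp add: mult.commute)
  have 2: "((\<lambda>y. exp t * y$2 + (P 1 (y$1) - (1/2) * (P 2 (y$1) * P 3 (y$1)) - P 3 (y$1) * y$3) / (c * y$1)) has_derivative
     (\<lambda>\<xi>. exp t * \<xi>$2 - ((\<pi>$3)\<^sup>2 / 2 + b * \<pi>$2 * (\<pi>$2 / 2 + y$3)) / (exp (- t) * (y$1)\<^sup>2) * \<xi>$1 - \<pi>$3 / (exp (- t) * y$1) * \<xi>$3)) (at y)"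
  proof -
    have nz: "c * y$1 \<noteq> 0" "y$1 \<noteq> 0" "c \<noteq> 0" using y c by simp_all
    show ?thesis unfolding c_def[symmetric]
      by (rule has_derivative_eq_rhs, rule has_derivative_add[OF has_derivative_mult[OF has_derivative_const n]
            has_derivative_divide[OF has_derivative_diff[OF has_derivative_diff[OF d
              has_derivative_mult[OF has_derivative_const has_derivative_mult[OF d d]]]
              has_derivative_mult[OF d n]] has_derivative_mult[OF has_derivative_const n] nz(1)]])
        (use nz in \<open>simp add: P\<pi> fun_eq_iff field_simps power2_eq_square\<close>)
  qed
  show ?thesis unfolding act by (rule has_derivative_vector3[OF 1 2 3])
qed

text \<open>The base point is the coset of the identity, so it is fixed by \<open>exp (s Y)\<close>. The derivative is a null
  rotation about the \<open>v\<close> direction.\<close>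

lemma action_isotropy:
  "action (0, s *\<^sub>R heis_Y) base = base"
  "(action (0, s *\<^sub>R heis_Y) has_derivative (\<lambda>\<xi>. vector [\<xi>$1, \<xi>$2 - s\<^sup>2 / 2 * \<xi>$1 - s * \<xi>$3, \<xi>$3 + s * \<xi>$1])) (at base)"
proof -
  show "action (0, s *\<^sub>R heis_Y) base = base" by (simp add: action_def Let_def)
  show "(action (0, s *\<^sub>R heis_Y) has_derivative (\<lambda>\<xi>. vector [\<xi>$1, \<xi>$2 - s\<^sup>2 / 2 * \<xi>$1 - s * \<xi>$3, \<xi>$3 + s * \<xi>$1])) (at base)"
    using action_has_derivative[of base "s *\<^sub>R heis_Y" 0 "s *\<^sub>R heis_Y"] by simp
qed

lemma action_to_base:
  assumes y: "y \<in> half_space"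
  obtains a where "action a y = base"
    "(action a has_derivative (\<lambda>\<xi>. vector [\<xi>$1 / y$1, y$1 * \<xi>$2 + b * (y$3)\<^sup>2 / (2 * y$1) * \<xi>$1, \<xi>$3])) (at y)"
proof -
  \<comment> \<open>Chosen so that translation by \<open>p\<close> brings \<open>v\<close> and \<open>x\<close> to 0 once \<open>u\<close> has been scaled to 1.\<close>
  define p :: heis where "p = vector [- y$1 * y$2, - y$3, 0]"
  let ?a = "(ln (y$1), p)"
  have e: "exp (- ln (y$1)) * y$1 = 1" "exp (- ln (y$1)) = 1 / y$1" using y by (simp_all add: exp_minus field_simps)
  have "action ?a y = base" using y by (simp add: action_def Let_def e p_def)
  moreover have "(action ?a has_derivative (\<lambda>\<xi>. vector [\<xi>$1 / y$1, y$1 * \<xi>$2 + b * (y$3)\<^sup>2 / (2 * y$1) * \<xi>$1, \<xi>$3])) (at y)"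
    by (rule has_derivative_eq_rhs[OF action_has_derivative[OF y, of p "ln (y$1)" p]])
      (use y in \<open>simp_all add: e p_def fun_eq_iff vector3_eq_iff power2_eq_square field_simps\<close>)
  ultimately show ?thesis using that by blast
qed

end

section \<open>Invariant metrics on the homogeneous space\<close>

text \<open>What the model supplies for \<open>G\<^sub>\<rho>\<close>: \<open>F\<close> is a submersion onto the half space whose fibres are the cosets
  of \<open>I\<close>, \<open>K a\<close> is left translation by \<open>a\<close> read off in the coordinates, and the last two assumptions
  give its derivative for the isotropy group of the base point and for one translation that carries
  a given point to the base point.\<close>

locale plane_wave_coordinates = lie_flow \<rho> A for \<rho> A +
  fixes W :: heis and b :: real
    and F :: "real \<times> heis \<Rightarrow> real^3" and K :: "real \<times> heis \<Rightarrow> real^3 \<Rightarrow> real^3"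
  assumes smooth_F: "smooth_on UNIV F"
    and F_half_space: "F g \<in> half_space"
    and fibre: "F g = F h \<longleftrightarrow> (\<exists>s. h = g \<otimes>\<^bsub>G_rho \<rho>\<^esub> (0, s *\<^sub>R W))"
    and local_section: "\<exists>\<sigma>. smooth_on half_space \<sigma> \<and> (\<forall>y\<in>half_space. F (\<sigma> y) = y) \<and> \<sigma> (F g) = g"
    and equivariant: "F (a \<otimes>\<^bsub>G_rho \<rho>\<^esub> g) = K a (F g)"
    and smooth_K: "smooth_on half_space (K a)"
    and isotropy: "\<exists>a. K a base = base \<and>
      (K a has_derivative (\<lambda>\<xi>. vector [\<xi>$1, \<xi>$2 - s\<^sup>2 / 2 * \<xi>$1 - s * \<xi>$3, \<xi>$3 + s * \<xi>$1])) (at base)"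
    and to_base: "y \<in> half_space \<Longrightarrow> \<exists>a. K a y = base \<and>
      (K a has_derivative (\<lambda>\<xi>. vector [\<xi>$1 / y$1, y$1 * \<xi>$2 + b * (y$3)\<^sup>2 / (2 * y$1) * \<xi>$1, \<xi>$3])) (at y)"
begin

abbreviation "P \<equiv> P_rho \<rho> W"
abbreviation "pr \<equiv> proj \<rho> W"

lemma pr_eq: "pr g = range (\<lambda>s. g \<otimes>\<^bsub>G_rho \<rho>\<^esub> (0, s *\<^sub>R W))"
  by (auto simp: proj_def l_coset_def one_param_subgroup_def)

lemma mem_pr_iff: "h \<in> pr g \<longleftrightarrow> F h = F g"
  unfolding pr_eq using fibre[of g h] by auto

lemma P_eq: "P = range pr"
  by (auto simp: P_rho_def LCOSETS_def proj_def)

lemma pr_eq_iff: "pr g = pr h \<longleftrightarrow> F g = F h"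
  using mem_pr_iff by (metis subset_antisym subsetI)

lemma F_surj:
  assumes "y \<in> half_space"
  obtains g where "F g = y"
  using local_section assms by blast

lemma translate_pr: "a <#\<^bsub>G_rho \<rho>\<^esub> pr g = pr (a \<otimes>\<^bsub>G_rho \<rho>\<^esub> g)"
proof -
  interpret group "G_rho \<rho>" by (rule group_G_rho)
  show ?thesis unfolding pr_eq l_coset_def by (auto simp: m_assoc)
qed

lemma K_inverse: "y \<in> half_space \<Longrightarrow> K (inv\<^bsub>G_rho \<rho>\<^esub> a) (K a y) = y"
proof -
  assume "y \<in> half_space"
  then obtain g where g: "F g = y" using F_surj by blast
  interpret group "G_rho \<rho>" by (rule group_G_rho)
  have "inv\<^bsub>G_rho \<rho>\<^esub> a \<otimes>\<^bsub>G_rho \<rho>\<^esub> (a \<otimes>\<^bsub>G_rho \<rho>\<^esub> g) = g"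
    by (simp add: m_assoc[symmetric] del: G_rho_simps(3))
  then show ?thesis by (metis g equivariant)
qed

lemma K_half_space: "y \<in> half_space \<Longrightarrow> K a y \<in> half_space"
  using F_surj F_half_space equivariant by metis

lemma surj_derivative_F: "surj (frechet_derivative F (at g))"
proof -
  obtain \<sigma> where \<sigma>: "smooth_on half_space \<sigma>" "\<And>y. y \<in> half_space \<Longrightarrow> F (\<sigma> y) = y" "\<sigma> (F g) = g"
    using local_section by blast
  have "surj (frechet_derivative F (at (\<sigma> (F g))))"
    by (rule surj_frechet_derivative_of_right_inverse[where g = \<sigma> and y = "F g", OF open_half_space F_half_space])
      (use \<sigma>(2) smooth_on_differentiable[OF smooth_F] smooth_on_differentiable[OF \<sigma>(1) F_half_space] in auto)
  then show ?thesis by (simp add: \<sigma>(3))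
qed

text \<open>Every global chart below arises from \<open>F\<close> by a change of coordinates \<open>\<theta>\<close> on the half space.\<close>

lemma chart:
  assumes \<psi>: "\<And>g. \<psi> (pr g) = \<theta> (F g)"
    and \<theta>: "smooth_on half_space \<theta>" "inj_on \<theta> half_space"
      "\<And>y. y \<in> half_space \<Longrightarrow> surj (frechet_derivative \<theta> (at y))"
  shows "(P, \<psi>) \<in> charts \<rho> W"
proof -
  have [simp]: "pr -` P = UNIV" by (auto simp: P_eq)
  have eq: "\<psi> \<circ> pr = (\<lambda>g. \<theta> (F g))" by (simp add: fun_eq_iff \<psi>)
  have "inj_on \<psi> P"
    using inj_onD[OF \<theta>(2)] F_half_space by (auto simp: P_eq inj_on_def \<psi> pr_eq_iff)
  moreover have "smooth_on UNIV (\<lambda>g. \<theta> (F g))"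
    by (rule smooth_on_compose[OF open_UNIV open_half_space \<theta>(1) smooth_F]) (use F_half_space in blast)
  moreover have "surj (frechet_derivative (\<lambda>g. \<theta> (F g)) (at g))" for g
  proof -
    have "(F has_derivative frechet_derivative F (at g)) (at g)"
      using smooth_on_differentiable[OF smooth_F] by (simp add: frechet_derivative_works[symmetric])
    moreover have "(\<theta> has_derivative frechet_derivative \<theta> (at (F g))) (at (F g))"
      using smooth_on_differentiable[OF \<theta>(1) F_half_space] by (simp add: frechet_derivative_works[symmetric])
    ultimately have "((\<lambda>g. \<theta> (F g)) has_derivative
        (\<lambda>v. frechet_derivative \<theta> (at (F g)) (frechet_derivative F (at g) v))) (at g)"
      by (rule has_derivative_compose)
    then have "frechet_derivative (\<lambda>g. \<theta> (F g)) (at g) = frechet_derivative \<theta> (at (F g)) \<circ> frechet_derivative F (at g)"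
      by (simp add: frechet_derivative_at[symmetric] o_def)
    then show ?thesis using comp_surj[OF surj_derivative_F \<theta>(3)[OF F_half_space]] by simp
  qed
  ultimately show ?thesis by (simp add: charts_def eq)
qed

definition global_chart :: "point \<Rightarrow> real^3" where
  "global_chart p = F (SOME g. g \<in> p)"

lemma global_chart_pr [simp]: "global_chart (pr g) = F g"
  unfolding global_chart_def using someI[of "\<lambda>h. h \<in> pr g" g] by (simp add: mem_pr_iff)

lemma global_chart: "(P, global_chart) \<in> charts \<rho> W"
proof (rule chart[where \<theta> = "\<lambda>y. y"])
  show "smooth_on half_space (\<lambda>y. y :: real^3)" by (rule smooth_on_bounded_linear[OF bounded_linear_ident])
qed (auto simp: frechet_derivative_ident)

lemma translated_chart:
  "translate_chart \<rho> W a (P, global_chart) = (P, \<lambda>p. global_chart (a <#\<^bsub>G_rho \<rho>\<^esub> p))"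
  by (auto simp: translate_chart_def P_eq translate_pr)

lemma translated_chart_in_charts: "(P, \<lambda>p. global_chart (a <#\<^bsub>G_rho \<rho>\<^esub> p)) \<in> charts \<rho> W"
proof (rule chart[where \<theta> = "K a"])
  show "global_chart (a <#\<^bsub>G_rho \<rho>\<^esub> pr g) = K a (F g)" for g
    by (simp add: translate_pr equivariant)
  show "inj_on (K a) half_space" using K_inverse by (rule inj_on_inverseI)
  show "surj (frechet_derivative (K a) (at y))" if "y \<in> half_space" for y
    using that K_half_space[OF that]
    by (intro surj_frechet_derivative_of_left_inverse[OF open_half_space that, of _ "K (inv\<^bsub>G_rho \<rho>\<^esub> a)"]
        smooth_on_differentiable[OF smooth_K] K_inverse)
qed (rule smooth_K)

text \<open>The transformation law of the metric, with the Jacobian expressed by the derivative of \<open>\<theta>\<close>.\<close>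

lemma change_of_chart:
  assumes m: "lorentz_metric (charts \<rho> W) m"
    and ch: "(P, \<psi>) \<in> charts \<rho> W" and \<psi>: "\<And>g. \<psi> (pr g) = \<theta> (F g)"
    and y: "y \<in> half_space" and D: "(\<theta> has_derivative D) (at y)"
  shows "\<xi> \<bullet> (m (P, global_chart) y *v \<xi>) = D \<xi> \<bullet> (m (P, \<psi>) (\<theta> y) *v D \<xi>)"
proof -
  obtain g where g: "F g = y" using F_surj[OF y] by blast
  have inj: "inj_on global_chart P" using global_chart by (simp add: charts_def)
  have "inv_into P global_chart (F h) = pr h" for h
    using inv_into_f_f[OF inj, of "pr h"] by (simp add: P_eq)
  then have "(\<psi> \<circ> inv_into P global_chart) z = \<theta> z" if "z \<in> half_space" for z
    using F_surj[OF that] \<psi> by (metis comp_apply)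
  then have "(\<psi> \<circ> inv_into P global_chart has_derivative D) (at y)"
    using has_derivative_transform_within_open[OF D open_half_space y] by metis
  then have fd: "frechet_derivative (\<psi> \<circ> inv_into P global_chart) (at y) = D"
    by (simp add: frechet_derivative_at[symmetric])
  have "pr g \<in> P \<inter> P" by (simp add: P_eq)
  then have "m (P, global_chart) y = transpose (matrix D) ** m (P, \<psi>) (\<theta> y) ** matrix D"
    using m global_chart ch unfolding lorentz_metric_def Let_def
    by (fastforce simp: fd g \<psi>)
  then have "\<xi> \<bullet> (m (P, global_chart) y *v \<xi>) = \<xi> \<bullet> (transpose (matrix D) *v (m (P, \<psi>) (\<theta> y) *v (matrix D *v \<xi>)))"
    by (simp add: matrix_vector_mul_assoc matrix_mul_assoc)
  also have "\<dots> = (matrix D *v \<xi>) \<bullet> (m (P, \<psi>) (\<theta> y) *v (matrix D *v \<xi>))"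
    by (simp only: transpose_matrix_vector inner_commute[of \<xi>] dot_lmul_matrix)
      (rule inner_commute)
  also have "matrix D *v \<xi> = D \<xi>"
    using has_derivative_linear[OF D] by (simp add: matrix_works)
  finally show ?thesis .
qed

end

lemma transpose_eq_self_entry:
  assumes "transpose S = S"
  shows "S$i$j = S$j$i"
proof -
  have "transpose S $ i $ j = S$j$i" by (simp add: transpose_def)
  then show ?thesis by (simp only: assms)
qed

lemma quadratic_form_expansion:
  fixes S :: "real^3^3"
  assumes "transpose S = S"
  shows "\<xi> \<bullet> (S *v \<xi>) = S$1$1 * (\<xi>$1)\<^sup>2 + S$2$2 * (\<xi>$2)\<^sup>2 + S$3$3 * (\<xi>$3)\<^sup>2
    + 2 * S$1$2 * \<xi>$1 * \<xi>$2 + 2 * S$1$3 * \<xi>$1 * \<xi>$3 + 2 * S$2$3 * \<xi>$2 * \<xi>$3"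
proof -
  have sym: "S$2$1 = S$1$2" "S$3$1 = S$1$3" "S$3$2 = S$2$3"
    by (rule transpose_eq_self_entry[OF assms])+
  show ?thesis
    by (simp add: inner_vec_def matrix_vector_mult_def sum_3 sym power2_eq_square algebra_simps)
qed

text \<open>Invariance of the coefficients under the null rotations with \<open>s = 1\<close> and \<open>s = -1\<close> leaves only the scale
  \<open>a\<close> and a multiple of \<open>du\<^sup>2\<close>. The determinant of the remaining form is \<open>- (a ^ 3)\<close>, so the signature
  forces \<open>a > 0\<close>.\<close>

lemma null_rotation_invariant_form:
  fixes S :: "real^3^3"
  assumes lor: "lorentz_form S"
    and inv: "\<And>s \<xi>. \<xi> \<bullet> (S *v \<xi>) =
      vector [\<xi>$1, \<xi>$2 - s\<^sup>2 / 2 * \<xi>$1 - s * \<xi>$3, \<xi>$3 + s * \<xi>$1] \<bullet>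
      (S *v vector [\<xi>$1, \<xi>$2 - s\<^sup>2 / 2 * \<xi>$1 - s * \<xi>$3, \<xi>$3 + s * \<xi>$1])"
  obtains a c where "a > 0" "\<And>\<xi>. \<xi> \<bullet> (S *v \<xi>) = a * (2 * \<xi>$1 * \<xi>$2 + (\<xi>$3)\<^sup>2) + c * (\<xi>$1)\<^sup>2"
proof -
  have sym: "transpose S = S" using lor by (simp add: lorentz_form_def)
  note ex = quadratic_form_expansion[OF sym]
  have 3: "S$2$2 - 2 * S$2$3 = 0" "S$2$2 + 2 * S$2$3 = 0"
    using inv[of "vector [0, 0, 1]" 1] inv[of "vector [0, 0, 1]" "-1"] by (simp_all add: ex)
  then have z: "S$2$2 = 0" "S$2$3 = 0" by simp_all
  have 1: "S$3$3 - S$1$2 + 2 * S$1$3 = 0" "S$3$3 - S$1$2 - 2 * S$1$3 = 0"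
    using inv[of "vector [1, 0, 0]" 1] inv[of "vector [1, 0, 0]" "-1"] by (simp_all add: ex z)
  then have z': "S$1$3 = 0" "S$1$2 = S$3$3" by simp_all
  have form: "\<xi> \<bullet> (S *v \<xi>) = S$3$3 * (2 * \<xi>$1 * \<xi>$2 + (\<xi>$3)\<^sup>2) + S$1$1 * (\<xi>$1)\<^sup>2" for \<xi>
    by (simp add: ex z z' algebra_simps)
  have s: "S$2$1 = S$1$2" "S$3$1 = S$1$3" "S$3$2 = S$2$3"
    by (rule transpose_eq_self_entry[OF sym])+
  have det: "det S = - (S$3$3 ^ 3)"
    by (simp add: det_3 s z z' power3_eq_cube)
  obtain Q :: "real^3^3" where Q: "invertible Q" and "transpose Q ** S ** Q = vector [vector [-1, 0, 0], vector [0, 1, 0], vector [0, 0, 1]]"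
    using lor by (auto simp: lorentz_form_def)
  then have "det (transpose Q ** S ** Q) = -1" by (simp add: det_3)
  then have "(det Q)\<^sup>2 * (S$3$3 ^ 3) = 1" by (simp add: det_mul det det_transpose power2_eq_square mult_ac)
  moreover from this have "(det Q)\<^sup>2 > 0" by (auto simp: zero_less_power2)
  ultimately have "S$3$3 ^ 3 > 0" using zero_less_mult_pos[of "(det Q)\<^sup>2" "S$3$3 ^ 3"] by simp
  then have "S$3$3 > 0" by (simp add: zero_less_power_eq)
  then show ?thesis using that form by blast
qed


text \<open>Left translations are isometries, so the form at the base point determines the metric everywhere: it is
  \<open>a\<close> times the plane wave metric plus \<open>c * du\<^sup>2 / u\<^sup>2\<close>. The term in \<open>c\<close> is absorbed by replacing \<open>v\<close> by
  \<open>v - c / (2 * a * u)\<close>, and the factor \<open>a\<close> by scaling \<open>v\<close> with \<open>a\<close> and \<open>x\<close> with \<open>sqrt a\<close>.\<close>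

theorem (in plane_wave_coordinates) plane_wave_chart:
  assumes m: "invariant_lorentz_metric \<rho> W m"
  shows "\<exists>\<Phi>. (P, \<Phi>) \<in> charts \<rho> W \<and> \<Phi> ` P = half_space \<and>
    (\<forall>y\<in>half_space. \<forall>\<xi>. \<xi> \<bullet> (m (P, \<Phi>) y *v \<xi>) = plane_wave b y \<xi>)"
proof -
  have met: "lorentz_metric (charts \<rho> W) m"
    and trans: "\<And>a y. y \<in> global_chart ` P \<Longrightarrow> m (translate_chart \<rho> W a (P, global_chart)) y = m (P, global_chart) y"
    using m global_chart unfolding invariant_lorentz_metric_def by fast+
  have img: "global_chart ` P = half_space"
    using F_surj F_half_space by (auto simp: P_eq image_iff) metis
  \<comment> \<open>Invariance under translation by \<open>a\<close>: the components in the translated chart, which is \<open>K a\<close> composed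
     with the original one, are the original components.\<close>
  have pull: "\<xi> \<bullet> (m (P, global_chart) y *v \<xi>) = D \<xi> \<bullet> (m (P, global_chart) (K a y) *v D \<xi>)"
    if "y \<in> half_space" "(K a has_derivative D) (at y)" for a y D \<xi>
  proof -
    have "m (P, \<lambda>p. global_chart (a <#\<^bsub>G_rho \<rho>\<^esub> p)) (K a y) = m (P, global_chart) (K a y)"
      using trans[of "K a y" a] K_half_space[OF that(1)] by (simp add: img translated_chart)
    then show ?thesis
      using change_of_chart[OF met translated_chart_in_charts _ that, of a \<xi>]
      by (simp add: translate_pr equivariant)
  qed
  have base: "base \<in> half_space" by simp
  let ?S = "m (P, global_chart) base"
  have lor: "lorentz_form ?S"
    using met global_chart base unfolding lorentz_metric_def by (fastforce simp: img)
  have rot: "\<xi> \<bullet> (?S *v \<xi>) =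
      vector [\<xi>$1, \<xi>$2 - s\<^sup>2 / 2 * \<xi>$1 - s * \<xi>$3, \<xi>$3 + s * \<xi>$1] \<bullet>
      (?S *v vector [\<xi>$1, \<xi>$2 - s\<^sup>2 / 2 * \<xi>$1 - s * \<xi>$3, \<xi>$3 + s * \<xi>$1])" for s \<xi>
  proof -
    obtain a where a: "K a base = base"
      "(K a has_derivative (\<lambda>\<xi>. vector [\<xi>$1, \<xi>$2 - s\<^sup>2 / 2 * \<xi>$1 - s * \<xi>$3, \<xi>$3 + s * \<xi>$1])) (at base)"
      using isotropy by blast
    show ?thesis using pull[OF base a(2), of \<xi>] by (simp only: a(1))
  qed
  obtain a c where a: "a > 0"
    and S: "\<And>\<xi>. \<xi> \<bullet> (?S *v \<xi>) = a * (2 * \<xi>$1 * \<xi>$2 + (\<xi>$3)\<^sup>2) + c * (\<xi>$1)\<^sup>2"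
    using null_rotation_invariant_form[OF lor rot] by blast
  have metric: "\<xi> \<bullet> (m (P, global_chart) y *v \<xi>) =
      a * (2 * \<xi>$1 * \<xi>$2 + b * (y$3)\<^sup>2 / (y$1)\<^sup>2 * (\<xi>$1)\<^sup>2 + (\<xi>$3)\<^sup>2) + c * (\<xi>$1)\<^sup>2 / (y$1)\<^sup>2"
    if y: "y \<in> half_space" for y \<xi>
  proof -
    let ?D = "\<lambda>\<xi>::real^3. vector [\<xi>$1 / y$1, y$1 * \<xi>$2 + b * (y$3)\<^sup>2 / (2 * y$1) * \<xi>$1, \<xi>$3] :: real^3"
    obtain k where k: "K k y = base" "(K k has_derivative ?D) (at y)" using to_base[OF y] by blast
    have "\<xi> \<bullet> (m (P, global_chart) y *v \<xi>) = ?D \<xi> \<bullet> (?S *v ?D \<xi>)"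
      using pull[OF y k(2), of \<xi>] by (simp only: k(1))
    also have "\<dots> = a * (2 * \<xi>$1 * \<xi>$2 + b * (y$3)\<^sup>2 / (y$1)\<^sup>2 * (\<xi>$1)\<^sup>2 + (\<xi>$3)\<^sup>2) + c * (\<xi>$1)\<^sup>2 / (y$1)\<^sup>2"
      unfolding S using y by (simp add: field_simps power2_eq_square)
    finally show ?thesis .
  qed
  define r where "r = sqrt a"
  have r: "r > 0" "r\<^sup>2 = a" using a by (simp_all add: r_def)
  define \<theta> :: "real^3 \<Rightarrow> real^3" where "\<theta> y = vector [y$1, a * y$2 - c / 2 * inverse (y$1), r * y$3]" for y
  define \<theta>' :: "real^3 \<Rightarrow> real^3" where "\<theta>' y = vector [y$1, (y$2 + c / 2 * inverse (y$1)) / a, y$3 / r]" for y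
  have inv: "\<theta>' (\<theta> y) = y" "\<theta> (\<theta>' y) = y" for y
    using a r by (simp_all add: \<theta>_def \<theta>'_def heis_eq_iff)
  have half: "\<theta> y \<in> half_space \<longleftrightarrow> y \<in> half_space" "\<theta>' y \<in> half_space \<longleftrightarrow> y \<in> half_space" for y
    by (simp_all add: \<theta>_def \<theta>'_def)
  have i: "smooth_on half_space (\<lambda>y. inverse (y$1))"
    by (rule smooth_on_compose[OF open_half_space open_greaterThan smooth_on_inverse smooth_on_vec_nth]) auto
  have smooth: "smooth_on half_space \<theta>" "smooth_on half_space \<theta>'"
    unfolding \<theta>_def \<theta>'_def divide_inverse
    by (intro smooth_on_vector3 smooth_on_mult smooth_on_add smooth_on_diff smooth_on_const smooth_on_vec_nth i open_half_space)+
  have D: "(\<theta> has_derivative (\<lambda>\<xi>. vector [\<xi>$1, a * \<xi>$2 + c / (2 * (y$1)\<^sup>2) * \<xi>$1, r * \<xi>$3])) (at y)"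
    if "y \<in> half_space" for y
  proof -
    note v = bounded_linear_imp_has_derivative[OF bounded_linear_vec_nth]
    show ?thesis unfolding \<theta>_def
      by (rule has_derivative_vector3)
        (use that in \<open>auto intro!: derivative_eq_intros v simp: fun_eq_iff field_simps power2_eq_square\<close>)
  qed
  define \<Phi> where "\<Phi> p = \<theta> (global_chart p)" for p
  have \<Phi>: "(P, \<Phi>) \<in> charts \<rho> W"
  proof (rule chart[where \<theta> = \<theta>])
    show "surj (frechet_derivative \<theta> (at y))" if "y \<in> half_space" for y
      using that half by (intro surj_frechet_derivative_of_left_inverse[OF open_half_space that, of _ \<theta>']
        smooth_on_differentiable[OF smooth(1)] smooth_on_differentiable[OF smooth(2)] inv) auto
    show "inj_on \<theta> half_space" using inv(1) by (rule inj_on_inverseI)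
  qed (simp_all add: \<Phi>_def smooth)
  have "\<Phi> ` P = \<theta> ` half_space" unfolding \<Phi>_def img[symmetric] by (simp add: image_image)
  also have "\<dots> = half_space"
  proof
    show "\<theta> ` half_space \<subseteq> half_space" using half(1) by blast
    show "half_space \<subseteq> \<theta> ` half_space"
    proof
      fix y assume "y \<in> half_space"
      then show "y \<in> \<theta> ` half_space" using half(2)[of y] inv(2)[of y] by (intro image_eqI[of y \<theta> "\<theta>' y"]) simp_all
    qed
  qed
  finally have "\<Phi> ` P = half_space" .
  moreover have "\<xi> \<bullet> (m (P, \<Phi>) y *v \<xi>) = plane_wave b y \<xi>" if y: "y \<in> half_space" for y \<xi>
  proof -
    let ?y = "\<theta>' y"
    \<comment> \<open>The preimage of \<open>\<xi>\<close> under the derivative of \<open>\<theta>\<close>.\<close>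
    let ?\<eta> = "vector [\<xi>$1, (\<xi>$2 - c / (2 * (y$1)\<^sup>2) * \<xi>$1) / a, \<xi>$3 / r] :: real^3"
    have y': "?y \<in> half_space" using y half by simp
    have y1: "?y $ 1 = y$1" "?y $ 3 = y$3 / r" by (simp_all add: \<theta>'_def)
    have "?\<eta> \<bullet> (m (P, global_chart) ?y *v ?\<eta>) = \<xi> \<bullet> (m (P, \<Phi>) y *v \<xi>)"
      using change_of_chart[OF met \<Phi> _ y' D[OF y'], of ?\<eta>] a r
      by (simp add: \<Phi>_def inv y1 vec3_eta)
    then have "\<xi> \<bullet> (m (P, \<Phi>) y *v \<xi>) = ?\<eta> \<bullet> (m (P, global_chart) ?y *v ?\<eta>)" by simp
    also have "\<dots> = plane_wave b y \<xi>"
      unfolding metric[OF y'] plane_wave_def y1 using a r(1) y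
      by (simp add: power_divide r(2)) (simp add: field_simps power2_eq_square)
    finally show ?thesis .
  qed
  ultimately show ?thesis using \<Phi> by blast
qed

section \<open>Classification\<close>

text \<open>Transport of the coordinates of the model along the isomorphism, which carries the subgroup
  generated by \<open>Y\<close> to the one generated by \<open>W\<close>.\<close>

lemma (in lie_flow) plane_wave_coordinates_exist:
  assumes "rate \<noteq> 0" "admissible \<rho> W"
  obtains b F K where "has_normal_form \<rho> b" "plane_wave_coordinates \<rho> A W b F K"
proof -
  obtain b \<tau> \<Psi> \<Psi>' where \<tau>: "lie_flow \<tau> ((*v) (normal_form b))" and nf: "has_normal_form \<rho> b"
    and iso: "smooth_iso_pair (G_rho \<tau>) (G_rho \<rho>) \<Psi> \<Psi>'"
    and W: "\<And>s. \<Psi> (0, s *\<^sub>R heis_Y) = (0, s *\<^sub>R W)"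
    by (rule model_isomorphism[OF assms], rule that)
  interpret M: model_flow \<tau> b using \<tau> by (simp add: model_flow_def)
  have \<Psi>: "\<Psi> (x \<otimes>\<^bsub>G_rho \<tau>\<^esub> y) = \<Psi> x \<otimes>\<^bsub>G_rho \<rho>\<^esub> \<Psi> y" and i: "\<Psi>' (\<Psi> x) = x" "\<Psi> (\<Psi>' z) = z"
    and sm: "smooth_on UNIV \<Psi>" "smooth_on UNIV \<Psi>'" for x y z
    using iso unfolding smooth_iso_pair_def by blast+
  have \<Psi>': "\<Psi>' (x \<otimes>\<^bsub>G_rho \<rho>\<^esub> y) = \<Psi>' x \<otimes>\<^bsub>G_rho \<tau>\<^esub> \<Psi>' y" for x y
    using smooth_iso_pair_sym[OF iso] unfolding smooth_iso_pair_def by blast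
  have "plane_wave_coordinates \<rho> A W b (\<lambda>g. M.coord (\<Psi>' g)) (\<lambda>a. M.action (\<Psi>' a))"
  proof (intro plane_wave_coordinates.intro lie_flow_axioms plane_wave_coordinates_axioms.intro)
    show "smooth_on UNIV (\<lambda>g. M.coord (\<Psi>' g))"
      by (rule smooth_on_compose[OF open_UNIV open_UNIV M.smooth_coord sm(2)]) simp
    show "M.coord (\<Psi>' g) \<in> half_space" for g by (rule M.range_coord)
    show "M.coord (\<Psi>' g) = M.coord (\<Psi>' h) \<longleftrightarrow> (\<exists>s. h = g \<otimes>\<^bsub>G_rho \<rho>\<^esub> (0, s *\<^sub>R W))" for g h
    proof -
      have "\<Psi>' h = \<Psi>' g \<otimes>\<^bsub>G_rho \<tau>\<^esub> (0, s *\<^sub>R heis_Y) \<longleftrightarrow> h = g \<otimes>\<^bsub>G_rho \<rho>\<^esub> (0, s *\<^sub>R W)" for s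
        by (metis \<Psi> W i)
      then show ?thesis by (simp only: M.coord_fibre)
    qed
    show "\<exists>\<sigma>. smooth_on half_space \<sigma> \<and> (\<forall>y\<in>half_space. M.coord (\<Psi>' (\<sigma> y)) = y) \<and> \<sigma> (M.coord (\<Psi>' g)) = g" for g
    proof -
      obtain s where s: "M.section_through s (M.coord (\<Psi>' g)) = \<Psi>' g" using M.section_through_coord by blast
      have "smooth_on half_space (\<lambda>y. \<Psi> (M.section_through s y))"
        by (rule smooth_on_compose[OF open_half_space open_UNIV sm(1) M.smooth_section]) simp
      then show ?thesis
        by (intro exI[of _ "\<lambda>y. \<Psi> (M.section_through s y)"]) (simp add: i s M.coord_section)
    qed
    show "M.coord (\<Psi>' (a \<otimes>\<^bsub>G_rho \<rho>\<^esub> g)) = M.action (\<Psi>' a) (M.coord (\<Psi>' g))" for a g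
      by (simp only: \<Psi>' M.coord_equivariant)
    show "smooth_on half_space (M.action (\<Psi>' a))" for a by (rule M.smooth_action)
    show "\<exists>a. M.action (\<Psi>' a) base = base \<and>
      (M.action (\<Psi>' a) has_derivative (\<lambda>\<xi>. vector [\<xi>$1, \<xi>$2 - s\<^sup>2 / 2 * \<xi>$1 - s * \<xi>$3, \<xi>$3 + s * \<xi>$1])) (at base)" for s
      using M.action_isotropy[of s] by (intro exI[of _ "\<Psi> (0, s *\<^sub>R heis_Y)"]) (simp only: i simp_thms)
    show "\<exists>a. M.action (\<Psi>' a) y = base \<and>
      (M.action (\<Psi>' a) has_derivative (\<lambda>\<xi>. vector [\<xi>$1 / y$1, y$1 * \<xi>$2 + b * (y$3)\<^sup>2 / (2 * y$1) * \<xi>$1, \<xi>$3])) (at y)"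
      if y: "y \<in> half_space" for y
    proof (rule M.action_to_base[OF y])
      fix a
      assume "M.action a y = base"
        "(M.action a has_derivative (\<lambda>\<xi>. vector [\<xi>$1 / y$1, y$1 * \<xi>$2 + b * (y$3)\<^sup>2 / (2 * y$1) * \<xi>$1, \<xi>$3])) (at y)"
      then show ?thesis by (intro exI[of _ "\<Psi> a"]) (simp only: i simp_thms)
    qed
  qed
  then show ?thesis using that nf by blast
qed

lemma non_unimodular_lie_flow:
  assumes "one_parameter_group \<rho>" "\<not> unimodular (G_rho \<rho>)"
  obtains A where "lie_flow \<rho> A" "lie_flow.rate A \<noteq> 0"
proof -
  obtain A where A: "lie_flow \<rho> A" using one_parameter_group_lie_flow[OF assms(1)] by blast
  have "lie_flow.rate A \<noteq> 0" using lie_flow.unimodular_if_rate_0[OF A] assms(2) by blast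
  then show ?thesis using that A by blast
qed

lemma b_invariant_eq:
  assumes "one_parameter_group \<rho>" "\<not> unimodular (G_rho \<rho>)" "has_normal_form \<rho> b"
  shows "b_invariant \<rho> = b"
proof -
  obtain A where A: "lie_flow \<rho> A" "lie_flow.rate A \<noteq> 0"
    using non_unimodular_lie_flow[OF assms(1,2)] by blast
  show ?thesis unfolding b_invariant_def
  proof (rule the_equality)
    show "has_normal_form \<rho> b" by fact
    show "c = b" if "has_normal_form \<rho> c" for c
      using lie_flow.has_normal_form_eq[OF A that] lie_flow.has_normal_form_eq[OF A assms(3)] by simp
  qed
qed

lemma isomorphic_to_model:
  assumes "one_parameter_group \<rho>" "\<not> unimodular (G_rho \<rho>)" "\<exists>W. admissible \<rho> W"
  obtains \<tau> \<Psi> \<Psi>' where "lie_flow \<tau> ((*v) (normal_form (b_invariant \<rho>)))" "has_normal_form \<rho> (b_invariant \<rho>)"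
    "smooth_iso_pair (G_rho \<tau>) (G_rho \<rho>) \<Psi> \<Psi>'"
proof -
  obtain A where A: "lie_flow \<rho> A" "lie_flow.rate A \<noteq> 0"
    using non_unimodular_lie_flow[OF assms(1,2)] by blast
  obtain W where W: "admissible \<rho> W" using assms(3) by blast
  show ?thesis
  proof (rule lie_flow.model_isomorphism[OF A W])
    fix b \<tau> \<Psi> \<Psi>'
    assume b: "lie_flow \<tau> ((*v) (normal_form b))" "has_normal_form \<rho> b" "smooth_iso_pair (G_rho \<tau>) (G_rho \<rho>) \<Psi> \<Psi>'"
    have "b_invariant \<rho> = b" by (rule b_invariant_eq[OF assms(1,2) b(2)])
    with b show ?thesis by (intro that[of \<tau> \<Psi> \<Psi>']) simp_all
  qed
qed

text \<open>Both groups are isomorphic to their models. Models with the same \<open>b\<close> coincide, because a flow is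
  determined by its generator.\<close>

theorem lie_isomorphic_iff_b_invariant_eq:
  assumes \<rho>: "one_parameter_group \<rho>" "\<not> unimodular (G_rho \<rho>)" "\<exists>W. admissible \<rho> W"
    and \<rho>': "one_parameter_group \<rho>'" "\<not> unimodular (G_rho \<rho>')" "\<exists>W. admissible \<rho>' W"
  shows "lie_isomorphic (G_rho \<rho>) (G_rho \<rho>') \<longleftrightarrow> b_invariant \<rho> = b_invariant \<rho>'"
proof -
  obtain \<tau> f g where \<tau>: "lie_flow \<tau> ((*v) (normal_form (b_invariant \<rho>)))"
    and f: "smooth_iso_pair (G_rho \<tau>) (G_rho \<rho>) f g"
    using isomorphic_to_model[OF \<rho>] by blast
  obtain \<tau>' f' g' where \<tau>': "lie_flow \<tau>' ((*v) (normal_form (b_invariant \<rho>')))"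
    and f': "smooth_iso_pair (G_rho \<tau>') (G_rho \<rho>') f' g'"
    using isomorphic_to_model[OF \<rho>'] by blast
  show ?thesis
  proof
    assume "lie_isomorphic (G_rho \<rho>) (G_rho \<rho>')"
    then obtain h k where "smooth_iso_pair (G_rho \<rho>) (G_rho \<rho>') h k"
      using lie_isomorphic_imp_smooth_iso_pair[OF G_rho_simps(1) G_rho_simps(1)] by blast
    from model_iso_imp_eq[OF \<tau> \<tau>' smooth_iso_pair_trans[OF smooth_iso_pair_trans[OF f this] smooth_iso_pair_sym[OF f']]]
    show "b_invariant \<rho> = b_invariant \<rho>'" .
  next
    assume "b_invariant \<rho> = b_invariant \<rho>'"
    then have "\<tau> = \<tau>'" using lie_flow_unique[OF \<tau>] \<tau>' by simp
    then show "lie_isomorphic (G_rho \<rho>) (G_rho \<rho>')"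
      using smooth_iso_pair_imp_lie_isomorphic[OF G_rho_simps(1) G_rho_simps(1)
          smooth_iso_pair_trans[OF smooth_iso_pair_sym[OF f]]] f' by blast
  qed
qed

theorem theorem1p4:
  fixes \<rho> :: "real \<Rightarrow> heis \<Rightarrow> heis"
  assumes "one_parameter_group \<rho>"
    and "\<not> unimodular (G_rho \<rho>)"
    and "\<exists>W. admissible \<rho> W"
  shows "(\<exists>!b. has_normal_form \<rho> b) \<and>
    (\<forall>W m. admissible \<rho> W \<and> invariant_lorentz_metric \<rho> W m \<longrightarrow>
       (\<exists>\<Phi>. (P_rho \<rho> W, \<Phi>) \<in> charts \<rho> W \<and> \<Phi> ` P_rho \<rho> W = {y. 0 < y$1} \<and>
          (\<forall>y. 0 < y$1 \<longrightarrow>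
             (\<forall>\<xi>. \<xi> \<bullet> (m (P_rho \<rho> W, \<Phi>) y *v \<xi>) = plane_wave (b_invariant \<rho>) y \<xi>)))) \<and>
    (\<forall>\<rho>'. one_parameter_group \<rho>' \<and> \<not> unimodular (G_rho \<rho>') \<and> (\<exists>W'. admissible \<rho>' W') \<longrightarrow>
       (lie_isomorphic (G_rho \<rho>) (G_rho \<rho>') \<longleftrightarrow> b_invariant \<rho> = b_invariant \<rho>'))"
proof (intro conjI allI impI)
  show "\<exists>!b. has_normal_form \<rho> b"
  proof (rule ex1I)
    show "has_normal_form \<rho> (b_invariant \<rho>)" by (rule isomorphic_to_model[OF assms])
    show "b = b_invariant \<rho>" if "has_normal_form \<rho> b" for b
      using b_invariant_eq[OF assms(1,2) that] by simp
  qed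
next
  fix W m assume Wm: "admissible \<rho> W \<and> invariant_lorentz_metric \<rho> W m"
  obtain A where A: "lie_flow \<rho> A" "lie_flow.rate A \<noteq> 0"
    using non_unimodular_lie_flow[OF assms(1,2)] by blast
  obtain b F K where b: "has_normal_form \<rho> b" and co: "plane_wave_coordinates \<rho> A W b F K"
    using lie_flow.plane_wave_coordinates_exist[OF A] Wm by blast
  show "\<exists>\<Phi>. (P_rho \<rho> W, \<Phi>) \<in> charts \<rho> W \<and> \<Phi> ` P_rho \<rho> W = {y. 0 < y$1} \<and>
          (\<forall>y. 0 < y$1 \<longrightarrow>
             (\<forall>\<xi>. \<xi> \<bullet> (m (P_rho \<rho> W, \<Phi>) y *v \<xi>) = plane_wave (b_invariant \<rho>) y \<xi>))"
    using plane_wave_coordinates.plane_wave_chart[OF co] Wm b_invariant_eq[OF assms(1,2) b] by simp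
next
  fix \<rho>' assume "one_parameter_group \<rho>' \<and> \<not> unimodular (G_rho \<rho>') \<and> (\<exists>W'. admissible \<rho>' W')"
  then show "lie_isomorphic (G_rho \<rho>) (G_rho \<rho>') \<longleftrightarrow> b_invariant \<rho> = b_invariant \<rho>'"
    using lie_isomorphic_iff_b_invariant_eq[OF assms] by blast
qed

end
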